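(* Let $m$ be a positive integer, let $\rho(\theta,t)=\cos(m\theta)\cos(mt)$, $J(\theta,t)=\sin(m\theta)\sin(mt)$ and $\overline J(\theta,t)=J(\theta,t)(-\sin\theta,\cos\theta,0)$ for $\theta\in[-\pi,\pi)$, $t\in\mathbb R$, and let $\overline E_m,\overline B_m$ be the causal fields determined from $(\rho,\overline J)$ by Jefimenko's equations (see context). Put $R=(r^2+1)^{1/2}$ and $P(r,t)=\int_{S(r)}(\overline E_m\times\overline B_m)\cdot d\overline S$. If $m$ is even, then $$P(r,t)=\beta\gamma m^2\Big[-\sin^2(mt)\cos^2\tfrac{mR}{c}-\cos^2(mt)\sin^2\tfrac{mR}{c}+2\sin(mt)\cos(mt)\sin\tfrac{mR}{c}\cos\tfrac{mR}{c}\Big]$$ $$\times\sum_{w=0}^\infty\sum_{w'=0}^\infty\ \sum_{\substack{s\le m,\ s'\le m\\ s,s'\ \mathrm{odd}}}(-1)^{\frac{s-1}2}\binom ms\frac{(-1)^wm^{2w+1}}{(2w+1)!\,(r^2+1)^{w+\frac12}}(-1)^{\frac{s'-1}2}\binom m{s'}\frac{(-1)^{w'}m^{2w'+1}}{(2w'+1)!\,(r^2+1)^{w'+\frac12}}\,r^{2w+2w'+5}\,c_{w,w',s,s',m}+O\big(\tfrac1r\big),$$ and if $m$ is odd, then $$P(r,t)=\beta\gamma m^2\Big[-\cos^2(mt)\cos^2\tfrac{mR}{c}-\sin^2(mt)\sin^2\tfrac{mR}{c}-2\sin(mt)\cos(mt)\sin\tfrac{mR}{c}\cos\tfrac{mR}{c}\Big]$$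 $$\times\sum_{w=0}^\infty\sum_{w'=0}^\infty\ \sum_{\substack{s\le m,\ s'\le m\\ s,s'\ \mathrm{odd}}}(-1)^{\frac{s-1}2}\binom ms\frac{(-1)^wm^{2w}}{(2w)!\,(r^2+1)^{w}}(-1)^{\frac{s'-1}2}\binom m{s'}\frac{(-1)^{w'}m^{2w'}}{(2w')!\,(r^2+1)^{w'}}\,r^{2w+2w'+3}\,d_{w,w',s,s',m}+O\big(\tfrac1r\big).$$
   Context: $\epsilon_0,\mu_0,c>0$ are the electromagnetic constants, $c^2=1/(\epsilon_0\mu_0)$. $S(r)\subset\mathbb R^3$ is the sphere of radius $r$ centred at the origin with outward normal. For a density $\rho(\theta,t)$ and current $\overline J(\theta,t)$ on the unit circle $S^1=\{(\cos\theta,\sin\theta,0)\}$, the causal fields given by Jefimenko's equations are, for $\overline r\in\mathbb R^3\setminus S^1$, with $\overline r'=(\cos\theta,\sin\theta,0)$, $\mathfrak r=|\overline r-\overline r'|$, $\hat{\overline{\mathfrak r}}=(\overline r-\overline r')/\mathfrak r$, $t_r=t-\mathfrak r/c$, $$\overline E(\overline r,t)=\frac1{4\pi\epsilon_0}\int_{-\pi}^{\pi}\Big[\frac{\rho(\theta,t_r)}{\mathfrak r^2}\hat{\overline{\mathfrak r}}+\frac{\dot\rho(\theta,t_r)}{c\,\mathfrak r}\hat{\overline{\mathfrak r}}-\frac{\dot{\overline J}(\theta,t_r)}{c^2\mathfrak r}\Big]d\theta,\qquad \overline B(\overline r,t)=\frac{\mu_0}{4\pi}\int_{-\pi}^{\pi}\Big[\frac{\overline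 J(\theta,t_r)}{\mathfrak r^2}+\frac{\dot{\overline J}(\theta,t_r)}{c\,\mathfrak r}\Big]\times\hat{\overline{\mathfrak r}}\,d\theta,$$ where the dot is the time derivative. $\beta=\frac{\mu_0}{4\pi c(r^2+1)}$, $\gamma=\frac1{4\pi\epsilon_0c^2(r^2+1)^{1/2}}$. For integers $\alpha,\delta\ge0$, $I_\alpha^\delta=\int_{-\pi}^{\pi}\cos^\alpha\theta\,\sin^\delta\theta\,d\theta$, and $K_n=\int_0^\pi\sin^n\phi\,d\phi$. In the following sums $v$ and $v'$ are nonnegative integers of the indicated parity. With $0\le v\le2w+1$, $0\le v'\le2w'+1$, and writing $[v,v']=\binom{2w+1}{v}\binom{2w'+1}{v'}$, $$c_{w,w',s,s',m}=-\sum_{v\,\mathrm{odd},v'\,\mathrm{even}}[v,v']I_{2w+2+m-s-v}^{s+v}I_{2w'+1+m-v'-s'}^{s'+v'+1}I_{2w+2w'+3-v-v'}^{v+v'+1}K_{2w+2w'+5}$$ $$-\sum_{v\,\mathrm{odd},v'\,\mathrm{odd}}[v,v']I_{2w+2+m-s-v}^{s+v}I_{2w'+2+m-v'-s'}^{s'+v'}I_{2w+2w'+4-v-v'}^{v+v'}K_{2w+2w'+5}$$ $$-\sum_{v\,\mathrm{even},v'\,\mathrm{even}}[v,v']I_{2w+1+m-s-v}^{s+v+1}I_{2w'+1+m-v'-s'}^{s'+v'+1}I_{2w+2w'+2-v-v'}^{v+v'+2}K_{2w+2w'+5}$$ $$-\sum_{v\,\mathrm{even},v'\,\mathrm{odd}}[v,v']I_{2w+1+m-s-v}^{s+v+1}I_{2w'+2+m-v'-s'}^{s'+v'}I_{2w+2w'+3-v-v'}^{v+v'+1}K_{2w+2w'+5}$$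 $$-\sum_{v\,\mathrm{even},v'\,\mathrm{even}}[v,v']I_{2w+1+m-s-v}^{s+v+1}I_{2w'+1+m-v'-s'}^{s'+v'+1}I_{2w+2w'+2-v-v'}^{v+v'}(K_{2w+2w'+3}-K_{2w+2w'+5})$$ $$-\sum_{v\,\mathrm{odd},v'\,\mathrm{odd}}[v,v']I_{2w+2+m-s-v}^{s+v}I_{2w'+2+m-v'-s'}^{s'+v'}I_{2w+2w'+2-v-v'}^{v+v'}(K_{2w+2w'+3}-K_{2w+2w'+5}).$$ With $0\le v\le2w$, $0\le v'\le2w'$, and writing $\langle v,v'\rangle=\binom{2w}{v}\binom{2w'}{v'}$, $$d_{w,w',s,s',m}=-\sum_{v\,\mathrm{odd},v'\,\mathrm{even}}\langle v,v'\rangle I_{2w+1+m-s-v}^{s+v}I_{2w'+m-v'-s'}^{s'+v'+1}I_{2w+2w'+1-v-v'}^{v+v'+1}K_{2w+2w'+3}$$ $$-\sum_{v\,\mathrm{odd},v'\,\mathrm{odd}}\langle v,v'\rangle I_{2w+1+m-s-v}^{s+v}I_{2w'+1+m-v'-s'}^{s'+v'}I_{2w+2w'+2-v-v'}^{v+v'}K_{2w+2w'+3}$$ $$-\sum_{v\,\mathrm{even},v'\,\mathrm{even}}\langle v,v'\rangle I_{2w+m-s-v}^{s+v+1}I_{2w'+m-v'-s'}^{s'+v'+1}I_{2w+2w'-v-v'}^{v+v'+2}K_{2w+2w'+3}$$ $$-\sum_{v\,\mathrm{even},v'\,\mathrm{odd}}\langle v,v'\rangle I_{2w+m-s-v}^{s+v+1}I_{2w'+1+m-v'-s'}^{s'+v'}I_{2w+2w'+1-v-v'}^{v+v'+1}K_{2w+2w'+3}$$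 $$-\sum_{v\,\mathrm{even},v'\,\mathrm{even}}\langle v,v'\rangle I_{2w+m-s-v}^{s+v+1}I_{2w'+m-v'-s'}^{s'+v'+1}I_{2w+2w'-v-v'}^{v+v'}(K_{2w+2w'+1}-K_{2w+2w'+3})$$ $$-\sum_{v\,\mathrm{odd},v'\,\mathrm{odd}}\langle v,v'\rangle I_{2w+1+m-s-v}^{s+v}I_{2w'+1+m-v'-s'}^{s'+v'}I_{2w+2w'-v-v'}^{v+v'}(K_{2w+2w'+1}-K_{2w+2w'+3}).$$ $O(1/r)$ is as $r\to\infty$.
   Formalization: In the two series the powers m^{2w+1}, m^{2w'+1} (m even) and m^{2w}, m^{2w'} (m odd) are replaced by the same powers of m/c; the printed formula agrees with this at c=1 but fails for general c (e.g. m=2 and c large). *)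

theory Defs
  imports "HOL-Analysis.Analysis" "HOL-Library.Landau_Symbols"
begin

unbundle cross3_syntax

section \<open>Jefimenko's equations on the unit circle\<close>

definition circ :: "real \<Rightarrow> real ^ 3" where
  "circ \<theta> = vector [cos \<theta>, sin \<theta>, 0]"

definition circ_tangent :: "real \<Rightarrow> real ^ 3" where
  "circ_tangent \<theta> = vector [- sin \<theta>, cos \<theta>, 0]"

definition sep :: "real ^ 3 \<Rightarrow> real \<Rightarrow> real" where
  "sep x \<theta> = norm (x - circ \<theta>)"

definition sep_dir :: "real ^ 3 \<Rightarrow> real \<Rightarrow> real ^ 3" where
  "sep_dir x \<theta> = (1 / sep x \<theta>) *\<^sub>R (x - circ \<theta>)"

definition ret_time :: "real \<Rightarrow> real ^ 3 \<Rightarrow> real \<Rightarrow> real \<Rightarrow> real" where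
  "ret_time c x t \<theta> = t - sep x \<theta> / c"

text \<open>The fields below are meant for points \<open>x\<close> off the unit circle. On the circle their
  values are junk and are never used.\<close>

definition jefimenko_E ::
  "real \<Rightarrow> real \<Rightarrow> (real \<Rightarrow> real \<Rightarrow> real) \<Rightarrow> (real \<Rightarrow> real \<Rightarrow> real ^ 3) \<Rightarrow> real ^ 3 \<Rightarrow> real \<Rightarrow> real ^ 3"
where
  "jefimenko_E \<epsilon>0 c \<rho> J x t =
     (1 / (4 * pi * \<epsilon>0)) *\<^sub>R integral {- pi..pi} (\<lambda>\<theta>. let tr = ret_time c x t \<theta> in
         (\<rho> \<theta> tr / (sep x \<theta>)\<^sup>2) *\<^sub>R sep_dir x \<theta>
       + (deriv (\<rho> \<theta>) tr / (c * sep x \<theta>)) *\<^sub>R sep_dir x \<theta>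
       - (1 / (c\<^sup>2 * sep x \<theta>)) *\<^sub>R vector_derivative (J \<theta>) (at tr))"

definition jefimenko_B ::
  "real \<Rightarrow> real \<Rightarrow> (real \<Rightarrow> real \<Rightarrow> real ^ 3) \<Rightarrow> real ^ 3 \<Rightarrow> real \<Rightarrow> real ^ 3"
where
  "jefimenko_B \<mu>0 c J x t =
     (\<mu>0 / (4 * pi)) *\<^sub>R integral {- pi..pi} (\<lambda>\<theta>. let tr = ret_time c x t \<theta> in
         ((1 / (sep x \<theta>)\<^sup>2) *\<^sub>R J \<theta> tr
          + (1 / (c * sep x \<theta>)) *\<^sub>R vector_derivative (J \<theta>) (at tr)) \<times> sep_dir x \<theta>)"

definition rho_m :: "nat \<Rightarrow> real \<Rightarrow> real \<Rightarrow> real" where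
  "rho_m m \<theta> t = cos (real m * \<theta>) * cos (real m * t)"

definition J_m :: "nat \<Rightarrow> real \<Rightarrow> real \<Rightarrow> real ^ 3" where
  "J_m m \<theta> t = (sin (real m * \<theta>) * sin (real m * t)) *\<^sub>R circ_tangent \<theta>"

definition E_m :: "real \<Rightarrow> real \<Rightarrow> nat \<Rightarrow> real ^ 3 \<Rightarrow> real \<Rightarrow> real ^ 3" where
  "E_m \<epsilon>0 c m = jefimenko_E \<epsilon>0 c (rho_m m) (J_m m)"

definition B_m :: "real \<Rightarrow> real \<Rightarrow> nat \<Rightarrow> real ^ 3 \<Rightarrow> real \<Rightarrow> real ^ 3" where
  "B_m \<mu>0 c m = jefimenko_B \<mu>0 c (J_m m)"


section \<open>Flux through a sphere\<close>

definition sph_normal :: "real \<Rightarrow> real \<Rightarrow> real ^ 3" where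
  "sph_normal \<phi> \<theta> = vector [sin \<phi> * cos \<theta>, sin \<phi> * sin \<theta>, cos \<phi>]"

text \<open>The surface integral of \<open>F \<bullet> n\<close> over the sphere of radius \<open>r\<close> about the origin, written out
  in spherical coordinates (\<open>\<phi>\<close> is the polar angle) with area element
  \<open>r\<^sup>2 sin \<phi> d\<theta> d\<phi>\<close>.\<close>

definition sphere_flux :: "real \<Rightarrow> (real ^ 3 \<Rightarrow> real ^ 3) \<Rightarrow> real" where
  "sphere_flux r F =
     integral {0..pi} (\<lambda>\<phi>. integral {- pi..pi} (\<lambda>\<theta>.
       (F (r *\<^sub>R sph_normal \<phi> \<theta>) \<bullet> sph_normal \<phi> \<theta>) * (r\<^sup>2 * sin \<phi>)))"

definition P_flux :: "real \<Rightarrow> real \<Rightarrow> real \<Rightarrow> nat \<Rightarrow> real \<Rightarrow> real \<Rightarrow> real" where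
  "P_flux \<epsilon>0 \<mu>0 c m r t = sphere_flux r (\<lambda>x. E_m \<epsilon>0 c m x t \<times> B_m \<mu>0 c m x t)"


section \<open>Coefficients\<close>

definition beta_coeff :: "real \<Rightarrow> real \<Rightarrow> real \<Rightarrow> real" where
  "beta_coeff \<mu>0 c r = \<mu>0 / (4 * pi * c * (r\<^sup>2 + 1))"

definition gamma_coeff :: "real \<Rightarrow> real \<Rightarrow> real \<Rightarrow> real" where
  "gamma_coeff \<epsilon>0 c r = 1 / (4 * pi * \<epsilon>0 * c\<^sup>2 * sqrt (r\<^sup>2 + 1))"

text \<open>The first argument of \<open>I_int\<close> is the power of the cosine (lower index), the second that of
  the sine (upper index).\<close>

definition I_int :: "nat \<Rightarrow> nat \<Rightarrow> real" where
  "I_int \<alpha> \<delta> = integral {- pi..pi} (\<lambda>\<theta>. cos \<theta> ^ \<alpha> * sin \<theta> ^ \<delta>)"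

definition K_int :: "nat \<Rightarrow> real" where
  "K_int n = integral {0..pi} (\<lambda>\<phi>. sin \<phi> ^ n)"

text \<open>For \<open>s \<le> m\<close> and \<open>s' \<le> m\<close>, the only case used, none of the natural number
  subtractions in the indices below truncates.\<close>

definition c_coeff :: "nat \<Rightarrow> nat \<Rightarrow> nat \<Rightarrow> nat \<Rightarrow> nat \<Rightarrow> real" where
  "c_coeff w w' s s' m =
    (let br = (\<lambda>v v'. real ((2*w+1) choose v) * real ((2*w'+1) choose v'));
         Od = {v. v \<le> 2*w+1 \<and> odd v};   Ev = {v. v \<le> 2*w+1 \<and> even v};
         Od' = {v'. v' \<le> 2*w'+1 \<and> odd v'}; Ev' = {v'. v' \<le> 2*w'+1 \<and> even v'}
     in
     - (\<Sum>v\<in>Od. \<Sum>v'\<in>Ev'. br v v' * I_int (2*w+2+m-s-v) (s+v) * I_int (2*w'+1+m-v'-s') (s'+v'+1)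
           * I_int (2*w+2*w'+3-v-v') (v+v'+1) * K_int (2*w+2*w'+5))
     - (\<Sum>v\<in>Od. \<Sum>v'\<in>Od'. br v v' * I_int (2*w+2+m-s-v) (s+v) * I_int (2*w'+2+m-v'-s') (s'+v')
           * I_int (2*w+2*w'+4-v-v') (v+v') * K_int (2*w+2*w'+5))
     - (\<Sum>v\<in>Ev. \<Sum>v'\<in>Ev'. br v v' * I_int (2*w+1+m-s-v) (s+v+1) * I_int (2*w'+1+m-v'-s') (s'+v'+1)
           * I_int (2*w+2*w'+2-v-v') (v+v'+2) * K_int (2*w+2*w'+5))
     - (\<Sum>v\<in>Ev. \<Sum>v'\<in>Od'. br v v' * I_int (2*w+1+m-s-v) (s+v+1) * I_int (2*w'+2+m-v'-s') (s'+v')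
           * I_int (2*w+2*w'+3-v-v') (v+v'+1) * K_int (2*w+2*w'+5))
     - (\<Sum>v\<in>Ev. \<Sum>v'\<in>Ev'. br v v' * I_int (2*w+1+m-s-v) (s+v+1) * I_int (2*w'+1+m-v'-s') (s'+v'+1)
           * I_int (2*w+2*w'+2-v-v') (v+v') * (K_int (2*w+2*w'+3) - K_int (2*w+2*w'+5)))
     - (\<Sum>v\<in>Od. \<Sum>v'\<in>Od'. br v v' * I_int (2*w+2+m-s-v) (s+v) * I_int (2*w'+2+m-v'-s') (s'+v')
           * I_int (2*w+2*w'+2-v-v') (v+v') * (K_int (2*w+2*w'+3) - K_int (2*w+2*w'+5))))"

definition d_coeff :: "nat \<Rightarrow> nat \<Rightarrow> nat \<Rightarrow> nat \<Rightarrow> nat \<Rightarrow> real" where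
  "d_coeff w w' s s' m =
    (let br = (\<lambda>v v'. real ((2*w) choose v) * real ((2*w') choose v'));
         Od = {v. v \<le> 2*w \<and> odd v};   Ev = {v. v \<le> 2*w \<and> even v};
         Od' = {v'. v' \<le> 2*w' \<and> odd v'}; Ev' = {v'. v' \<le> 2*w' \<and> even v'}
     in
     - (\<Sum>v\<in>Od. \<Sum>v'\<in>Ev'. br v v' * I_int (2*w+1+m-s-v) (s+v) * I_int (2*w'+m-v'-s') (s'+v'+1)
           * I_int (2*w+2*w'+1-v-v') (v+v'+1) * K_int (2*w+2*w'+3))
     - (\<Sum>v\<in>Od. \<Sum>v'\<in>Od'. br v v' * I_int (2*w+1+m-s-v) (s+v) * I_int (2*w'+1+m-v'-s') (s'+v')
           * I_int (2*w+2*w'+2-v-v') (v+v') * K_int (2*w+2*w'+3))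
     - (\<Sum>v\<in>Ev. \<Sum>v'\<in>Ev'. br v v' * I_int (2*w+m-s-v) (s+v+1) * I_int (2*w'+m-v'-s') (s'+v'+1)
           * I_int (2*w+2*w'-v-v') (v+v'+2) * K_int (2*w+2*w'+3))
     - (\<Sum>v\<in>Ev. \<Sum>v'\<in>Od'. br v v' * I_int (2*w+m-s-v) (s+v+1) * I_int (2*w'+1+m-v'-s') (s'+v')
           * I_int (2*w+2*w'+1-v-v') (v+v'+1) * K_int (2*w+2*w'+3))
     - (\<Sum>v\<in>Ev. \<Sum>v'\<in>Ev'. br v v' * I_int (2*w+m-s-v) (s+v+1) * I_int (2*w'+m-v'-s') (s'+v'+1)
           * I_int (2*w+2*w'-v-v') (v+v') * (K_int (2*w+2*w'+1) - K_int (2*w+2*w'+3)))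
     - (\<Sum>v\<in>Od. \<Sum>v'\<in>Od'. br v v' * I_int (2*w+1+m-s-v) (s+v) * I_int (2*w'+1+m-v'-s') (s'+v')
           * I_int (2*w+2*w'-v-v') (v+v') * (K_int (2*w+2*w'+1) - K_int (2*w+2*w'+3))))"


section \<open>The double series\<close>

text \<open>The powers of \<open>m / c\<close> come from expanding \<open>sin (m u / c)\<close> and \<open>cos (m u / c)\<close> with
  \<open>u = r sin \<phi> cos (\<theta> - \<theta>') / sqrt (r\<^sup>2 + 1)\<close>. At \<open>x = r *\<^sub>R sph_normal \<phi> \<theta>\<close> this is the
  leading term of \<open>sqrt (r\<^sup>2 + 1) - sep x \<theta>'\<close>, which enters through the retarded time. The source
  prints powers of \<open>m\<close> alone, which is this formula at \<open>c = 1\<close> and is not valid for other \<open>c\<close>.\<close>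

definition odd_idx :: "nat \<Rightarrow> nat set" where
  "odd_idx m = {s. s \<le> m \<and> odd s}"

definition even_term :: "real \<Rightarrow> nat \<Rightarrow> real \<Rightarrow> nat \<Rightarrow> nat \<Rightarrow> real" where
  "even_term c m r w w' = (\<Sum>s\<in>odd_idx m. \<Sum>s'\<in>odd_idx m.
      (- 1) ^ ((s - 1) div 2) * real (m choose s)
    * ((- 1) ^ w * (real m / c) ^ (2*w+1) / (fact (2*w+1) * (r\<^sup>2 + 1) powr (real w + 1/2)))
    * (- 1) ^ ((s' - 1) div 2) * real (m choose s')
    * ((- 1) ^ w' * (real m / c) ^ (2*w'+1) / (fact (2*w'+1) * (r\<^sup>2 + 1) powr (real w' + 1/2)))
    * r ^ (2*w+2*w'+5) * c_coeff w w' s s' m)"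

definition odd_term :: "real \<Rightarrow> nat \<Rightarrow> real \<Rightarrow> nat \<Rightarrow> nat \<Rightarrow> real" where
  "odd_term c m r w w' = (\<Sum>s\<in>odd_idx m. \<Sum>s'\<in>odd_idx m.
      (- 1) ^ ((s - 1) div 2) * real (m choose s)
    * ((- 1) ^ w * (real m / c) ^ (2*w) / (fact (2*w) * (r\<^sup>2 + 1) ^ w))
    * (- 1) ^ ((s' - 1) div 2) * real (m choose s')
    * ((- 1) ^ w' * (real m / c) ^ (2*w') / (fact (2*w') * (r\<^sup>2 + 1) ^ w'))
    * r ^ (2*w+2*w'+3) * d_coeff w w' s s' m)"

text \<open>Convergence of an iterated series, inner sums first. It is asserted separately because
  \<open>suminf\<close> of a divergent series is an arbitrary value.\<close>

definition iter_summable :: "(nat \<Rightarrow> nat \<Rightarrow> real) \<Rightarrow> bool" where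
  "iter_summable f \<longleftrightarrow> (\<forall>w. summable (f w)) \<and> summable (\<lambda>w. \<Sum>w'. f w w')"

end

theory Submission
  imports Defs
begin

text \<open>On the sphere of radius \<open>r\<close> the distance to the source point at angle \<open>s\<close> is
  \<open>R - u + O(1/r)\<close> with \<open>R = sqrt (r\<^sup>2 + 1)\<close> and \<open>u = (r / R) sin \<phi> cos (\<theta> - s)\<close>, so up to
  \<open>O(1/r\<^sup>2)\<close> the fields are \<open>E = a n - b j\<close> and \<open>B = b' j \<times> n\<close>, where \<open>n\<close> is the normal and \<open>j\<close> is
  the integral of the current derivative at the approximate retarded time. The charge term \<open>a n\<close>
  drops out of \<open>(E \<times> B) \<bullet> n = b b' (j \<bullet> j - (j \<bullet> n)\<^sup>2)\<close>. In the phase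
  \<open>m (t - R / c) + (m / c) u\<close> the shift \<open>s \<mapsto> s + \<pi>\<close> kills the part of \<open>j\<close> with \<open>cos (m u / c)\<close> if \<open>m\<close>
  is even and the part with \<open>sin (m u / c)\<close> if \<open>m\<close> is odd. Expanding the surviving sine or cosine
  in its everywhere convergent power series, \<open>sin (m s)\<close> by de Moivre and \<open>cos (\<theta> - s) ^ p\<close> by the
  binomial theorem, and integrating termwise gives the double series.\<close>

section \<open>Double integrals over the parameter rectangle\<close>

text \<open>The orders fit exactly: both fields are O(1/R) with error O(1/R^2), so the density of
  the flux has error O(1/R^3), uniformly in the angles, and the area factor r^2 leaves O(1/r).
  Distances are expanded around \<open>R\<close> rather than \<open>r\<close> because |r n - p|^2 =
  R^2 - 2 R u for the source point p, which is (R - u)^2 up to u^2. The shift u is of order 1: it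
  may be dropped from amplitudes but not from phases, and this is why a sine or cosine of m u / c
  survives and has to be expanded.

  Only this far field step is asymptotic. The double series equals a double integral for every
  \<open>r\<close>: j . j - (j . n)^2 is a quadratic form, its polarisation takes two copies of the
  surviving function, each copy is expanded separately, and the M-test on a compact set justifies
  both interchanges of sum and integral.

  One mismatch remains. The area element and the fields give r^2 / R^2, whereas
  \<open>beta_coeff\<close>, \<open>gamma_coeff\<close> and the powers of \<open>r\<close> in the
  series give r^3 / R^3. Since R - r is at most 1, this costs another O(1/r).\<close>

definition iint :: "(real \<Rightarrow> real \<Rightarrow> real) \<Rightarrow> real" where
  "iint f = integral {0..pi} (\<lambda>\<phi>. integral {- pi..pi} (f \<phi>))"

text \<open>Relational form, so that the values of finite linear combinations compose by
  introduction rules without separate integrability conditions. The inner integral is required for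
  every \<phi>, which lets \<open>F\<close> be identified with it as a function.\<close>

definition has_iint :: "(real \<Rightarrow> real \<Rightarrow> real) \<Rightarrow> real \<Rightarrow> bool" where
  "has_iint f I \<longleftrightarrow>
     (\<exists>F. (\<forall>\<phi>. (f \<phi> has_integral F \<phi>) {- pi..pi}) \<and> (F has_integral I) {0..pi})"

lemma has_iint_iint: "has_iint f I \<Longrightarrow> iint f = I"
  unfolding has_iint_def iint_def by (metis integral_unique ext)

lemma has_iint_cmult: "has_iint f I \<Longrightarrow> has_iint (\<lambda>\<phi> \<theta>. k * f \<phi> \<theta>) (k * I)"
  unfolding has_iint_def
  by (elim exE, rule_tac x = "\<lambda>\<phi>. k * F \<phi>" in exI) (auto intro: has_integral_mult_right)

lemma has_iint_add:
  assumes "has_iint f I" "has_iint g J"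
  shows "has_iint (\<lambda>\<phi> \<theta>. f \<phi> \<theta> + g \<phi> \<theta>) (I + J)"
proof -
  obtain F G where "\<forall>\<phi>. (f \<phi> has_integral F \<phi>) {- pi..pi}" "(F has_integral I) {0..pi}"
    "\<forall>\<phi>. (g \<phi> has_integral G \<phi>) {- pi..pi}" "(G has_integral J) {0..pi}"
    using assms unfolding has_iint_def by blast
  then show ?thesis
    unfolding has_iint_def
    by (intro exI[of _ "\<lambda>\<phi>. F \<phi> + G \<phi>"]) (auto intro: has_integral_add)
qed

lemma has_iint_zero: "has_iint (\<lambda>\<phi> \<theta>. 0) 0"
  unfolding has_iint_def by (intro exI[of _ "\<lambda>_. 0"]) auto

lemma has_iint_sum:
  "finite A \<Longrightarrow> (\<And>a. a \<in> A \<Longrightarrow> has_iint (f a) (I a)) \<Longrightarrow>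
    has_iint (\<lambda>\<phi> \<theta>. \<Sum>a\<in>A. f a \<phi> \<theta>) (\<Sum>a\<in>A. I a)"
  by (induction rule: finite_induct) (auto simp: has_iint_zero has_iint_add)

lemma has_integral_K_int: "((\<lambda>\<phi>. sin \<phi> ^ n) has_integral K_int n) {0..pi}"
  unfolding K_int_def
  by (intro integrable_integral integrable_continuous_interval continuous_intros)

lemma has_integral_I_int:
  "((\<lambda>\<theta>. cos \<theta> ^ a * sin \<theta> ^ b) has_integral I_int a b) {- pi..pi}"
  unfolding I_int_def
  by (intro integrable_integral integrable_continuous_interval continuous_intros)

lemma has_iint_monomial:
  "has_iint (\<lambda>\<phi> \<theta>. sin \<phi> ^ n * (cos \<theta> ^ a * sin \<theta> ^ b)) (I_int a b * K_int n)"
  unfolding has_iint_def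
proof (intro exI conjI allI)
  show "((\<lambda>\<theta>. sin \<phi> ^ n * (cos \<theta> ^ a * sin \<theta> ^ b)) has_integral (sin \<phi> ^ n * I_int a b))
    {- pi..pi}" for \<phi>
    by (intro has_integral_mult_right has_integral_I_int)
  show "((\<lambda>\<phi>. sin \<phi> ^ n * I_int a b) has_integral (I_int a b * K_int n)) {0..pi}"
    using has_integral_mult_left[OF has_integral_K_int, of n "I_int a b"]
    by (simp add: mult.commute)
qed

lemma I_int_odd: "odd b \<Longrightarrow> I_int a b = 0"
  using Henstock_Kurzweil_Integration.integral_reflect_real
    [where f = "\<lambda>\<theta>. cos \<theta> ^ a * sin \<theta> ^ b" and a = "-pi" and b = pi]
  by (simp add: I_int_def power_minus_odd)

text \<open>The Weierstrass M-test gives uniform convergence, and integrals over a box pass to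
  uniform limits. The general domain serves both the source angle (an interval) and the sphere
  parameters (a rectangle).\<close>

lemma sums_integral_cbox:
  fixes f :: "nat \<Rightarrow> 'a::euclidean_space \<Rightarrow> real"
  assumes cont: "\<And>n. continuous_on (cbox a b) (f n)"
    and bnd: "\<And>n x. x \<in> cbox a b \<Longrightarrow> \<bar>f n x\<bar> \<le> M n"
    and M: "summable M"
    and g: "\<And>x. x \<in> cbox a b \<Longrightarrow> (\<lambda>n. f n x) sums g x"
  shows "(\<lambda>n. integral (cbox a b) (f n)) sums integral (cbox a b) g"
proof -
  have "uniform_limit (cbox a b) (\<lambda>n x. \<Sum>i<n. f i x) (\<lambda>x. suminf (\<lambda>i. f i x)) sequentially"
    by (rule Weierstrass_m_test[OF _ M]) (use bnd in auto)
  then have ul: "uniform_limit (cbox a b) (\<lambda>n x. \<Sum>i<n. f i x) g sequentially"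
    by (rule uniform_limit_cong'[THEN iffD1, rotated -1]) (use g in \<open>auto simp: sums_iff\<close>)
  have c: "continuous_on (cbox a b) (\<lambda>x. \<Sum>i<n. f i x)" for n
    by (intro continuous_on_sum cont)
  obtain I J where I: "\<And>n. ((\<lambda>x. \<Sum>i<n. f i x) has_integral I n) (cbox a b)"
    and J: "(g has_integral J) (cbox a b)" and IJ: "(I \<longlongrightarrow> J) sequentially"
    by (rule uniform_limit_integral_cbox[OF ul c]) auto
  have "I = (\<lambda>n. \<Sum>i<n. integral (cbox a b) (f i))"
    using integral_unique[OF I] integral_sum[of _ f "cbox a b"]
    by (auto simp: fun_eq_iff integrable_continuous cont)
  then show "(\<lambda>n. integral (cbox a b) (f n)) sums integral (cbox a b) g"
    using IJ integral_unique[OF J] by (simp add: sums_def)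
qed

text \<open>Fubini for continuous integrands; with it bounds and series need one argument on the
  rectangle instead of two nested ones.\<close>

lemma iint_2dim:
  assumes "continuous_on UNIV (\<lambda>z. f (fst z) (snd z))"
  shows "iint f = integral (cbox (0, -pi) (pi, pi)) (\<lambda>z. f (fst z) (snd z))"
  using integral_prod_continuous[of 0 "-pi" pi pi "\<lambda>z. f (fst z) (snd z)"]
    continuous_on_subset[OF assms]
  by (simp add: iint_def)

lemma sums_iint:
  assumes cont: "\<And>n. continuous_on UNIV (\<lambda>z. f n (fst z) (snd z))"
    and g: "continuous_on UNIV (\<lambda>z. g (fst z) (snd z))"
    and bnd: "\<And>n \<phi> \<theta>. \<bar>f n \<phi> \<theta>\<bar> \<le> M n"
    and M: "summable M"
    and sums: "\<And>\<phi> \<theta>. (\<lambda>n. f n \<phi> \<theta>) sums g \<phi> \<theta>"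
  shows "(\<lambda>n. iint (f n)) sums iint g"
  unfolding iint_2dim[OF cont] iint_2dim[OF g]
  by (rule sums_integral_cbox[where M = M])
    (use assms in \<open>auto intro: continuous_on_subset\<close>)

lemma integral_bound_interval:
  fixes f :: "real \<Rightarrow> 'a::euclidean_space"
  assumes "a \<le> b" "continuous_on {a..b} f" "\<And>x. x \<in> {a..b} \<Longrightarrow> norm (f x) \<le> B"
  shows "norm (integral {a..b} f) \<le> B * (b - a)"
  by (rule integral_bound[OF assms(1,2)]) (use assms(3) in auto)

text \<open>The constant is the area of the rectangle with sides \<open>pi\<close> and
  \<open>2 * pi\<close>.\<close>

lemma iint_abs_le:
  assumes cont: "continuous_on UNIV (\<lambda>z. f (fst z) (snd z))"
    and B: "\<And>\<phi> \<theta>. \<bar>f \<phi> \<theta>\<bar> \<le> B"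
  shows "\<bar>iint f\<bar> \<le> 2 * pi\<^sup>2 * B"
proof -
  have "0 \<le> B" using B[of 0 0] by linarith
  then have "\<bar>iint f\<bar> \<le> B * measure lborel (cbox (0, -pi) (pi, pi))"
    unfolding iint_2dim[OF cont]
    using has_integral_bound[OF _ integrable_integral, of B "\<lambda>z. f (fst z) (snd z)" "(0,-pi)" "(pi,pi)"]
      B integrable_continuous[OF continuous_on_subset[OF cont subset_UNIV]]
    by auto
  also have "measure lborel (cbox (0::real, -pi) (pi, pi)) = 2 * pi\<^sup>2"
    by (simp add: content_Pair power2_eq_square)
  finally show ?thesis by (simp add: mult.commute)
qed

section \<open>The coefficients as double integrals\<close>

text \<open>For \<open>a = (x, y, 0)\<close>, \<open>b = (x', y', 0)\<close> and \<open>n = sph_normal \<phi> \<theta>\<close> this is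
  \<open>a \<bullet> b - (a \<bullet> n) (b \<bullet> n)\<close>.\<close>

definition transverse ::
  "real \<Rightarrow> real \<Rightarrow> real \<Rightarrow> real \<Rightarrow> real \<Rightarrow> real \<Rightarrow> real" where
  "transverse \<phi> \<theta> x y x' y' = x * x' + y * y'
     - (sin \<phi>)\<^sup>2 * (x * cos \<theta> + y * sin \<theta>) * (x' * cos \<theta> + y' * sin \<theta>)"

lemma transverse_sum_left:
  "transverse \<phi> \<theta> (\<Sum>a\<in>A. k a * x a) (\<Sum>a\<in>A. k a * y a) x' y'
     = (\<Sum>a\<in>A. k a * transverse \<phi> \<theta> (x a) (y a) x' y')"
  unfolding transverse_def
  by (induction A rule: infinite_finite_induct) (auto simp: algebra_simps)

lemma transverse_commute: "transverse \<phi> \<theta> x y x' y' = transverse \<phi> \<theta> x' y' x y"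
  by (simp add: transverse_def algebra_simps)

text \<open>\<open>transverse\<close> is a symmetric bilinear form in the two pairs: linearity on
  the left gives linearity on the right.\<close>

lemma transverse_sum:
  "transverse \<phi> \<theta> (\<Sum>a\<in>A. k a * x a) (\<Sum>a\<in>A. k a * y a)
      (\<Sum>b\<in>B. l b * x' b) (\<Sum>b\<in>B. l b * y' b)
     = (\<Sum>a\<in>A. \<Sum>b\<in>B. k a * l b * transverse \<phi> \<theta> (x a) (y a) (x' b) (y' b))"
  by (subst transverse_sum_left, subst transverse_commute, subst transverse_sum_left)
    (simp add: sum_distrib_left mult.assoc transverse_commute)

text \<open>Common form of \<open>c_coeff\<close> (odd powers \<open>p = 2 w + 1\<close>) and \<open>d_coeff\<close> (even powers \<open>p = 2 w\<close>).\<close>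

definition flux_coeff :: "nat \<Rightarrow> nat \<Rightarrow> nat \<Rightarrow> nat \<Rightarrow> nat \<Rightarrow> real" where
  "flux_coeff p p' s s' m =
    (let br = (\<lambda>v v'. real (p choose v) * real (p' choose v'));
         Od = {v. v \<le> p \<and> odd v};   Ev = {v. v \<le> p \<and> even v};
         Od' = {v'. v' \<le> p' \<and> odd v'}; Ev' = {v'. v' \<le> p' \<and> even v'}
     in
     - (\<Sum>v\<in>Od. \<Sum>v'\<in>Ev'. br v v' * I_int (p+1+m-s-v) (s+v) * I_int (p'+m-v'-s') (s'+v'+1)
           * I_int (p+p'+1-v-v') (v+v'+1) * K_int (p+p'+3))
     - (\<Sum>v\<in>Od. \<Sum>v'\<in>Od'. br v v' * I_int (p+1+m-s-v) (s+v) * I_int (p'+1+m-v'-s') (s'+v')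
           * I_int (p+p'+2-v-v') (v+v') * K_int (p+p'+3))
     - (\<Sum>v\<in>Ev. \<Sum>v'\<in>Ev'. br v v' * I_int (p+m-s-v) (s+v+1) * I_int (p'+m-v'-s') (s'+v'+1)
           * I_int (p+p'-v-v') (v+v'+2) * K_int (p+p'+3))
     - (\<Sum>v\<in>Ev. \<Sum>v'\<in>Od'. br v v' * I_int (p+m-s-v) (s+v+1) * I_int (p'+1+m-v'-s') (s'+v')
           * I_int (p+p'+1-v-v') (v+v'+1) * K_int (p+p'+3))
     - (\<Sum>v\<in>Ev. \<Sum>v'\<in>Ev'. br v v' * I_int (p+m-s-v) (s+v+1) * I_int (p'+m-v'-s') (s'+v'+1)
           * I_int (p+p'-v-v') (v+v') * (K_int (p+p'+1) - K_int (p+p'+3)))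
     - (\<Sum>v\<in>Od. \<Sum>v'\<in>Od'. br v v' * I_int (p+1+m-s-v) (s+v) * I_int (p'+1+m-v'-s') (s'+v')
           * I_int (p+p'-v-v') (v+v') * (K_int (p+p'+1) - K_int (p+p'+3))))"

lemma c_coeff_eq: "c_coeff w w' s s' m = flux_coeff (2*w+1) (2*w'+1) s s' m"
proof -
  have 1: "2*w+1+1 = 2*w+2" "2*w'+1+1 = 2*w'+2"
    "2*w+1+(2*w'+1)+1 = 2*w+2*w'+3" "2*w+1+(2*w'+1) = 2*w+2*w'+2"
    "2*w+2*w'+2+2 = 2*w+2*w'+4" "2*w+2*w'+2+3 = 2*w+2*w'+5" "2*w+2*w'+2+1 = 2*w+2*w'+3"
    by simp_all
  show ?thesis
    unfolding c_coeff_def flux_coeff_def 1 Let_def by (rule refl)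
qed

lemma d_coeff_eq: "d_coeff w w' s s' m = flux_coeff (2*w) (2*w') s s' m"
  unfolding d_coeff_def flux_coeff_def Let_def by (rule refl)

text \<open>Puts the six sums of \<open>flux_coeff\<close>, each with its own parity restriction,
  over one common index set, so that they can be merged term by term.\<close>

lemma sum_atMost_restrict2:
  fixes f :: "nat \<Rightarrow> nat \<Rightarrow> real"
  assumes "\<And>v v'. \<not> (P v \<and> Q v') \<Longrightarrow> f v v' = 0"
  shows "(\<Sum>v\<in>{v. v \<le> p \<and> P v}. \<Sum>v'\<in>{v'. v' \<le> q \<and> Q v'}. f v v') = (\<Sum>v\<le>p. \<Sum>v'\<le>q. f v v')"
proof -
  have "(\<Sum>v'\<in>{v'. v' \<le> q \<and> Q v'}. f v v') = (\<Sum>v'\<le>q. f v v')" for v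
    by (rule sum.mono_neutral_left) (use assms in auto)
  moreover have "(\<Sum>v\<in>{v. v \<le> p \<and> P v}. \<Sum>v'\<le>q. f v v') = (\<Sum>v\<le>p. \<Sum>v'\<le>q. f v v')"
    by (rule sum.mono_neutral_left) (use assms in \<open>auto intro!: sum.neutral\<close>)
  ultimately show ?thesis by simp
qed

text \<open>Integral over the source angle z of one product of expansion terms:
  \<open>cos z ^ (m - s) * sin z ^ s\<close> from sin (m z),
  \<open>cos z ^ (p - v) * sin z ^ v\<close> from the power of the cosine of the angle difference,
  and the tangent component \<open>- sin z\<close> (for \<open>y_int\<close>: \<open>cos z\<close>).
  The binomial factors and the sign from de Moivre are kept outside.\<close>

definition x_int :: "nat \<Rightarrow> nat \<Rightarrow> nat \<Rightarrow> nat \<Rightarrow> real" where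
  "x_int m p s v = - I_int (p + m - s - v) (s + v + 1)"

definition y_int :: "nat \<Rightarrow> nat \<Rightarrow> nat \<Rightarrow> nat \<Rightarrow> real" where
  "y_int m p s v = I_int (p + 1 + m - s - v) (s + v)"

text \<open>The parity restrictions in the coefficients only omit terms in which some \<open>I_int\<close> has an odd
  power of the sine. The products with \<open>(-1)\<close> give the right-hand side the shape produced by
  \<open>has_iint_cmult\<close> and \<open>has_iint_add\<close>.\<close>

lemma flux_coeff_all_parities:
  assumes "odd s" "odd s'"
  shows "- flux_coeff p p' s s' m = (\<Sum>v\<le>p. \<Sum>v'\<le>p'. real (p choose v) * real (p' choose v') *
    (- (y_int m p s v * x_int m p' s' v' + x_int m p s v * y_int m p' s' v')
         * (I_int (p+p'+1-v-v') (v+v'+1) * K_int (p+p'+3))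
     + y_int m p s v * y_int m p' s' v' * (I_int (p+p'+2-v-v') (v+v') * K_int (p+p'+3)
         + (I_int (p+p'-v-v') (v+v') * K_int (p+p'+1) + (-1) * (I_int (p+p'-v-v') (v+v') * K_int (p+p'+3))))
     + x_int m p s v * x_int m p' s' v' * (I_int (p+p'-v-v') (v+v'+2) * K_int (p+p'+3)
         + (I_int (p+p'-v-v') (v+v') * K_int (p+p'+1) + (-1) * (I_int (p+p'-v-v') (v+v') * K_int (p+p'+3))))))"
proof -
  have x0: "I_int n (s + v + 1) = 0" if "odd v" for n v using that assms by (simp add: I_int_odd)
  have y0: "I_int n (s + v) = 0" if "even v" for n v using that assms by (simp add: I_int_odd)
  have x0': "I_int n (s' + v + 1) = 0" if "odd v" for n v using that assms by (simp add: I_int_odd)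
  have y0': "I_int n (s' + v) = 0" if "even v" for n v using that assms by (simp add: I_int_odd)
  \<comment> \<open>The coefficients subtract \<open>v'\<close> before \<open>s'\<close>, while
    \<open>x_int\<close> and \<open>y_int\<close> subtract \<open>s\<close> before
    \<open>v\<close>.\<close>
  have comm: "n - v - s' = n - s' - v" for n v by simp
  show ?thesis
    unfolding flux_coeff_def Let_def comm
    apply (subst sum_atMost_restrict2, use x0 y0 x0' y0' in force)+
    apply (simp only: minus_diff_eq minus_minus sum.distrib[symmetric] sum_subtractf[symmetric]
        diff_minus_eq_add sum_negf[symmetric])
    apply (intro sum.cong refl)
    unfolding x_int_def y_int_def
    \<comment> \<open>With all sums merged, each summand is a polynomial identity in values of
      \<open>I_int\<close> and \<open>K_int\<close>.\<close>
    apply algebra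
    done
qed

text \<open>What remains, as a function of the observation angle \<theta>, once the source angle has
  been integrated out for a fixed de Moivre index \<open>s\<close>.\<close>

definition x_trig :: "nat \<Rightarrow> nat \<Rightarrow> nat \<Rightarrow> real \<Rightarrow> real" where
  "x_trig m p s \<theta> = (\<Sum>v\<le>p. real (p choose v) * cos \<theta> ^ (p - v) * sin \<theta> ^ v * x_int m p s v)"

definition y_trig :: "nat \<Rightarrow> nat \<Rightarrow> nat \<Rightarrow> real \<Rightarrow> real" where
  "y_trig m p s \<theta> = (\<Sum>v\<le>p. real (p choose v) * cos \<theta> ^ (p - v) * sin \<theta> ^ v * y_int m p s v)"

text \<open>To be read with C = cos \<theta>, S = sin \<theta>, k = sin \<phi>. The factors 1 - k^2
  C^2 and 1 - k^2 S^2 are deliberately written as k^2 S^2 + (1 - k^2) and k^2 C^2 + (1 - k^2): this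
  is the splitting behind the coefficients, where 1 - k^2 becomes a difference of two values of
  \<open>K_int\<close>.\<close>

lemma monomial_identity:
  fixes C S k x y x' y' :: real
  assumes "C\<^sup>2 + S\<^sup>2 = 1"
  shows "x * x' + y * y' - k\<^sup>2 * (x * C + y * S) * (x' * C + y' * S) =
    - (y * x' + x * y') * (k\<^sup>2 * (C * S)) + y * y' * (k\<^sup>2 * C\<^sup>2 + (1 + (-1) * k\<^sup>2))
    + x * x' * (k\<^sup>2 * S\<^sup>2 + (1 + (-1) * k\<^sup>2))"
proof -
  have "S\<^sup>2 = 1 - C\<^sup>2" using assms by simp
  then have "x * x' * S\<^sup>2 = x * x' * (1 - C\<^sup>2)" "y * y' * S\<^sup>2 = y * y' * (1 - C\<^sup>2)" by simp_all
  then show ?thesis using assms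
    by (simp add: algebra_simps power2_eq_square)  algebra
qed

text \<open>Of the powers of sin \<phi>, \<open>p + p'\<close> come from the arguments of the two
  expanded functions and one from the area element. The minus sign is the one built into
  \<open>flux_coeff\<close>.\<close>

lemma has_iint_trig:
  assumes "odd s" "odd s'"
  shows "has_iint (\<lambda>\<phi> \<theta>. sin \<phi> ^ (p+p'+1) *
    transverse \<phi> \<theta> (x_trig m p s \<theta>) (y_trig m p s \<theta>) (x_trig m p' s' \<theta>) (y_trig m p' s' \<theta>))
    (- flux_coeff p p' s s' m)"
proof -
  let ?M = "\<lambda>n a b \<phi> \<theta>. sin \<phi> ^ n * (cos \<theta> ^ a * sin \<theta> ^ b)"
  let ?g = "\<lambda>\<phi> \<theta>. \<Sum>v\<le>p. \<Sum>v'\<le>p'. real (p choose v) * real (p' choose v') *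
    (- (y_int m p s v * x_int m p' s' v' + x_int m p s v * y_int m p' s' v')
         * ?M (p+p'+3) (p+p'+1-v-v') (v+v'+1) \<phi> \<theta>
     + y_int m p s v * y_int m p' s' v' * (?M (p+p'+3) (p+p'+2-v-v') (v+v') \<phi> \<theta>
         + (?M (p+p'+1) (p+p'-v-v') (v+v') \<phi> \<theta> + (-1) * ?M (p+p'+3) (p+p'-v-v') (v+v') \<phi> \<theta>))
     + x_int m p s v * x_int m p' s' v' * (?M (p+p'+3) (p+p'-v-v') (v+v'+2) \<phi> \<theta>
         + (?M (p+p'+1) (p+p'-v-v') (v+v') \<phi> \<theta> + (-1) * ?M (p+p'+3) (p+p'-v-v') (v+v') \<phi> \<theta>)))"
  have "has_iint ?g (- flux_coeff p p' s s' m)"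
    unfolding flux_coeff_all_parities[OF assms]
    by (intro has_iint_sum has_iint_cmult has_iint_add has_iint_monomial) auto
  moreover have "?g \<phi> \<theta> = sin \<phi> ^ (p+p'+1) *
    transverse \<phi> \<theta> (x_trig m p s \<theta>) (y_trig m p s \<theta>) (x_trig m p' s' \<theta>) (y_trig m p' s' \<theta>)"
    for \<phi> \<theta>
    unfolding x_trig_def y_trig_def transverse_sum sum_distrib_left
  proof (intro sum.cong refl, goal_cases)
    case (1 v v')
    \<comment> \<open>Writing \<open>p - v\<close> as \<open>a\<close> removes the natural number
      subtractions from the exponents.\<close>
    then obtain a a' where a: "p = v + a" "p' = v' + a'" by (auto simp: le_iff_add)
    define C S k where "C = cos \<theta>" "S = sin \<theta>" "k = sin \<phi>"
    have e: "p+p'+1-v-v' = a+a'+1" "p+p'+2-v-v' = a+a'+2" "p+p'-v-v' = a+a'" "p - v = a" "p' - v' = a'"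
      using a by auto
    define x x' y y' where "x = x_int m p s v" "x' = x_int m p' s' v'"
      "y = y_int m p s v" "y' = y_int m p' s' v'"
    note abb = C_S_k_def[symmetric] x_x'_y_y'_def[symmetric]
    have "C\<^sup>2 + S\<^sup>2 = 1" by (simp add: C_S_k_def)
    note id = monomial_identity[OF this, of x x' y y' k]
    \<comment> \<open>The common factor of all the monomials; the quotients by \<open>N\<close> are
      exactly the terms on the right of \<open>monomial_identity\<close>.\<close>
    define N where "N = k ^ (p+p'+1) * (C ^ (a+a') * S ^ (v+v'))"
    have N: "k ^ (p+p'+1) * (C ^ (a+a') * S ^ (v+v')) = N"
      "k ^ (p+p'+3) * (C ^ (a+a') * S ^ (v+v')) = N * k\<^sup>2"
      "k ^ (p+p'+3) * (C ^ (a+a'+1) * S ^ (v+v'+1)) = N * (k\<^sup>2 * (C * S))"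
      "k ^ (p+p'+3) * (C ^ (a+a'+2) * S ^ (v+v')) = N * (k\<^sup>2 * C\<^sup>2)"
      "k ^ (p+p'+3) * (C ^ (a+a') * S ^ (v+v'+2)) = N * (k\<^sup>2 * S\<^sup>2)"
      by (simp_all add: N_def power_add power3_eq_cube power2_eq_square mult_ac)
    have R: "k ^ (p+p'+1) * (real (p choose v) * C ^ a * S ^ v *
        (real (p' choose v') * C ^ a' * S ^ v') * T) = real (p choose v) * real (p' choose v') * (N * T)" for T
      by (simp add: N_def power_add mult_ac)
    have F: "- u * (N * a) + w * (N * b + (N + (-1) * (N * e))) + z * (N * d + (N + (-1) * (N * e)))
        = N * (- u * a + w * (b + (1 + (-1) * e)) + z * (d + (1 + (-1) * e)))"
      for u w z a b d e :: real
      by (simp add: algebra_simps)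
    show ?case
      unfolding e transverse_def abb N R id F ..
  qed
  ultimately show ?thesis by simp
qed

section \<open>Moments of the current as trigonometric polynomials\<close>

lemma cos_diff_power:
  "cos (\<theta> - s) ^ p =
    (\<Sum>v\<le>p. real (p choose v) * cos \<theta> ^ (p - v) * sin \<theta> ^ v * (cos s ^ (p - v) * sin s ^ v))"
  unfolding cos_diff add.commute[of "cos \<theta> * cos s"] binomial_ring
  by (intro sum.cong refl) (simp add: power_mult_distrib)

lemma Im_i_power: "Im (\<i> ^ s) = (if odd s then (-1) ^ ((s - 1) div 2) else 0)"
proof -
  have "\<i> ^ (2 * k) = of_real ((-1) ^ k)" for k
    by (simp add: power_mult)
  then show ?thesis
    by (cases "odd s") (auto elim!: oddE evenE simp del: of_real_power)
qed

text \<open>In the binomial expansion of (cos \<theta> + i sin \<theta>)^m only the odd powers of i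
  have a nonzero imaginary part; this produces both the index set \<open>odd_idx m\<close> and the
  signs.\<close>

lemma sin_multiple_expansion:
  "sin (real m * \<theta>) =
    (\<Sum>s\<in>odd_idx m. (-1) ^ ((s - 1) div 2) * real (m choose s) * (cos \<theta> ^ (m - s) * sin \<theta> ^ s))"
proof -
  have "sin (real m * \<theta>) = Im (cis \<theta> ^ m)"
    by (simp add: Complex.DeMoivre)
  also have "cis \<theta> = \<i> * of_real (sin \<theta>) + of_real (cos \<theta>)"
    by (simp add: complex_eq_iff)
  also have "Im (\<dots> ^ m) = (\<Sum>s\<le>m. Im (\<i> ^ s * of_real (real (m choose s) * (cos \<theta> ^ (m - s) * sin \<theta> ^ s))))"
    unfolding binomial_ring Im_sum
    by (intro sum.cong refl arg_cong[of _ _ Im]) (simp add: power_mult_distrib)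
  also have "\<dots> = (\<Sum>s\<in>odd_idx m. Im (\<i> ^ s * of_real (real (m choose s) * (cos \<theta> ^ (m - s) * sin \<theta> ^ s))))"
    by (rule sum.mono_neutral_right)
      (auto simp: odd_idx_def Im_i_power simp del: of_real_mult of_real_power)
  also have "\<dots> = (\<Sum>s\<in>odd_idx m. (-1) ^ ((s - 1) div 2) * real (m choose s) * (cos \<theta> ^ (m - s) * sin \<theta> ^ s))"
    by (intro sum.cong refl)
      (auto simp: odd_idx_def Im_i_power simp del: of_real_mult of_real_power)
  finally show ?thesis .
qed

text \<open>The first two components of the integral of \<open>sin (m s) f (cos (\<theta> - s))\<close> times the unit tangent
  at angle \<open>s\<close>.\<close>

definition x_moment :: "nat \<Rightarrow> (real \<Rightarrow> real) \<Rightarrow> real \<Rightarrow> real" where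
  "x_moment m f \<theta> = integral {- pi..pi} (\<lambda>s. - (sin (real m * s) * sin s) * f (cos (\<theta> - s)))"

definition y_moment :: "nat \<Rightarrow> (real \<Rightarrow> real) \<Rightarrow> real \<Rightarrow> real" where
  "y_moment m f \<theta> = integral {- pi..pi} (\<lambda>s. sin (real m * s) * cos s * f (cos (\<theta> - s)))"

lemma odd_idx_finite [simp]: "finite (odd_idx m)"
  by (simp add: odd_idx_def)

lemma x_moment_power:
  "x_moment m (\<lambda>z. z ^ p) \<theta> =
    (\<Sum>s\<in>odd_idx m. (-1) ^ ((s - 1) div 2) * real (m choose s) * x_trig m p s \<theta>)"
  unfolding x_moment_def
proof (rule integral_unique, goal_cases)
  case 1
  have "((\<lambda>z. \<Sum>s\<in>odd_idx m. (-1) ^ ((s - 1) div 2) * real (m choose s) *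
      (\<Sum>v\<le>p. real (p choose v) * cos \<theta> ^ (p - v) * sin \<theta> ^ v *
         - (cos z ^ (p + m - s - v) * sin z ^ (s + v + 1)))) has_integral
    (\<Sum>s\<in>odd_idx m. (-1) ^ ((s - 1) div 2) * real (m choose s) * x_trig m p s \<theta>)) {-pi..pi}"
    unfolding x_trig_def x_int_def
    by (intro has_integral_sum has_integral_mult_right has_integral_neg has_integral_I_int) auto
  moreover have "(\<Sum>s\<in>odd_idx m. (-1) ^ ((s - 1) div 2) * real (m choose s) *
      (\<Sum>v\<le>p. real (p choose v) * cos \<theta> ^ (p - v) * sin \<theta> ^ v *
         - (cos z ^ (p + m - s - v) * sin z ^ (s + v + 1))))
      = - (sin (real m * z) * sin z) * cos (\<theta> - z) ^ p" for z
  proof -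
    have pw: "cos z ^ (p + m - s - v) * sin z ^ (s + v + 1) =
        (cos z ^ (m - s) * sin z ^ s) * (cos z ^ (p - v) * sin z ^ v) * sin z"
      if "s \<in> odd_idx m" "v \<le> p" for s v
    proof -
      have "p + m - s - v = (m - s) + (p - v)" using that by (auto simp: odd_idx_def)
      then show ?thesis by (simp only: power_add power_one_right mult_ac)
    qed
    \<comment> \<open>The tangent component is pulled in front, so that the rest is a product of two
      finite expansions and \<open>sum_product\<close> applies.\<close>
    have "- (sin (real m * z) * sin z) * cos (\<theta> - z) ^ p
        = - sin z * (sin (real m * z) * cos (\<theta> - z) ^ p)" by simp
    note eq = this
    show ?thesis
      unfolding eq
      unfolding sin_multiple_expansion[of m z] cos_diff_power
      unfolding sum_product
      unfolding sum_distrib_left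
    proof (intro sum.cong[OF refl], goal_cases)
      case (1 s v)
      then have "v \<le> p" by simp
      show ?case unfolding pw[OF 1(1) \<open>v \<le> p\<close>] by (simp add: mult_ac)
    qed
  qed
  ultimately show ?case by simp
qed

lemma y_moment_power:
  "y_moment m (\<lambda>z. z ^ p) \<theta> =
    (\<Sum>s\<in>odd_idx m. (-1) ^ ((s - 1) div 2) * real (m choose s) * y_trig m p s \<theta>)"
  unfolding y_moment_def
proof (rule integral_unique, goal_cases)
  case 1
  have "((\<lambda>z. \<Sum>s\<in>odd_idx m. (-1) ^ ((s - 1) div 2) * real (m choose s) *
      (\<Sum>v\<le>p. real (p choose v) * cos \<theta> ^ (p - v) * sin \<theta> ^ v *
         (cos z ^ (p + 1 + m - s - v) * sin z ^ (s + v)))) has_integral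
    (\<Sum>s\<in>odd_idx m. (-1) ^ ((s - 1) div 2) * real (m choose s) * y_trig m p s \<theta>)) {-pi..pi}"
    unfolding y_trig_def y_int_def
    by (intro has_integral_sum has_integral_mult_right has_integral_I_int) auto
  moreover have "(\<Sum>s\<in>odd_idx m. (-1) ^ ((s - 1) div 2) * real (m choose s) *
      (\<Sum>v\<le>p. real (p choose v) * cos \<theta> ^ (p - v) * sin \<theta> ^ v *
         (cos z ^ (p + 1 + m - s - v) * sin z ^ (s + v))))
      = sin (real m * z) * cos z * cos (\<theta> - z) ^ p" for z
  proof -
    have pw: "cos z ^ (p + 1 + m - s - v) * sin z ^ (s + v) =
        (cos z ^ (m - s) * sin z ^ s) * (cos z ^ (p - v) * sin z ^ v) * cos z"
      if "s \<in> odd_idx m" "v \<le> p" for s v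
    proof -
      have "p + 1 + m - s - v = (m - s) + (p - v) + 1" using that by (auto simp: odd_idx_def)
      then show ?thesis by (simp only: power_add power_one_right mult_ac)
    qed
    have "sin (real m * z) * cos z * cos (\<theta> - z) ^ p
        = cos z * (sin (real m * z) * cos (\<theta> - z) ^ p)" by simp
    note eq = this
    show ?thesis
      unfolding eq
      unfolding sin_multiple_expansion[of m z] cos_diff_power
      unfolding sum_product
      unfolding sum_distrib_left
    proof (intro sum.cong[OF refl], goal_cases)
      case (1 s v)
      then have "v \<le> p" by simp
      show ?case unfolding pw[OF 1(1) \<open>v \<le> p\<close>] by (simp add: mult_ac)
    qed
  qed
  ultimately show ?case by simp
qed

lemma iint_moment_power:
  "iint (\<lambda>\<phi> \<theta>. sin \<phi> ^ (p+p'+1) *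
      transverse \<phi> \<theta> (x_moment m (\<lambda>z. z ^ p) \<theta>) (y_moment m (\<lambda>z. z ^ p) \<theta>)
        (x_moment m (\<lambda>z. z ^ p') \<theta>) (y_moment m (\<lambda>z. z ^ p') \<theta>))
    = - (\<Sum>s\<in>odd_idx m. \<Sum>s'\<in>odd_idx m. (-1) ^ ((s - 1) div 2) * real (m choose s) *
        ((-1) ^ ((s' - 1) div 2) * real (m choose s')) * flux_coeff p p' s s' m)"
proof (rule has_iint_iint)
  have "has_iint (\<lambda>\<phi> \<theta>. \<Sum>s\<in>odd_idx m. \<Sum>s'\<in>odd_idx m. (-1) ^ ((s - 1) div 2) * real (m choose s) *
        ((-1) ^ ((s' - 1) div 2) * real (m choose s')) * (sin \<phi> ^ (p+p'+1) *
    transverse \<phi> \<theta> (x_trig m p s \<theta>) (y_trig m p s \<theta>) (x_trig m p' s' \<theta>) (y_trig m p' s' \<theta>)))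
    (\<Sum>s\<in>odd_idx m. \<Sum>s'\<in>odd_idx m. (-1) ^ ((s - 1) div 2) * real (m choose s) *
        ((-1) ^ ((s' - 1) div 2) * real (m choose s')) * - flux_coeff p p' s s' m)"
    by (intro has_iint_sum has_iint_cmult has_iint_trig) (auto simp: odd_idx_def)
  then show "has_iint (\<lambda>\<phi> \<theta>. sin \<phi> ^ (p+p'+1) *
      transverse \<phi> \<theta> (x_moment m (\<lambda>z. z ^ p) \<theta>) (y_moment m (\<lambda>z. z ^ p) \<theta>)
        (x_moment m (\<lambda>z. z ^ p') \<theta>) (y_moment m (\<lambda>z. z ^ p') \<theta>))
    (- (\<Sum>s\<in>odd_idx m. \<Sum>s'\<in>odd_idx m. (-1) ^ ((s - 1) div 2) * real (m choose s) *
        ((-1) ^ ((s' - 1) div 2) * real (m choose s')) * flux_coeff p p' s s' m))"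
    unfolding x_moment_power y_moment_power transverse_sum sum_distrib_left
    by (simp add: sum_negf algebra_simps)
qed

section \<open>Termwise integration\<close>

lemma continuous_on_moment:
  assumes "continuous_on UNIV h"
  shows "continuous_on UNIV (\<lambda>z. x_moment m (\<lambda>u. h (\<kappa> * sin (fst z) * u)) (snd z))" (is ?x)
    and "continuous_on UNIV (\<lambda>z. y_moment m (\<lambda>u. h (\<kappa> * sin (fst z) * u)) (snd z))" (is ?y)
proof -
  note [continuous_intros] = continuous_on_compose2[OF assms]
  show ?x
    unfolding x_moment_def cbox_interval[symmetric]
    by (rule integral_continuous_on_param) (auto simp: case_prod_unfold intro!: continuous_intros)
  show ?y
    unfolding y_moment_def cbox_interval[symmetric]
    by (rule integral_continuous_on_param) (auto simp: case_prod_unfold intro!: continuous_intros)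
qed

lemma abs_prod3_le:
  fixes u v w :: real
  assumes "\<bar>u\<bar> \<le> k" "\<bar>v\<bar> \<le> 1" "\<bar>w\<bar> \<le> B"
  shows "\<bar>u * v * w\<bar> \<le> k * B"
proof -
  have "\<bar>u\<bar> * \<bar>v\<bar> * \<bar>w\<bar> \<le> k * 1 * B"
    by (intro mult_mono) (use assms in \<open>auto intro: order_trans[OF abs_ge_zero]\<close>)
  then show ?thesis by (simp add: abs_mult)
qed

text \<open>The weights are products of sines and cosines and the source interval has length
  \<open>2 * pi\<close>. A bound for \<open>f\<close> on [-1, 1] suffices because its argument is a
  cosine; there the monomials are at most 1, which makes the later majorants summable.\<close>

lemma moment_bound:
  assumes "continuous_on UNIV f" and "\<And>u. \<bar>u\<bar> \<le> 1 \<Longrightarrow> \<bar>f u\<bar> \<le> B"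
  shows "\<bar>x_moment m f \<theta>\<bar> \<le> 2 * pi * B" and "\<bar>y_moment m f \<theta>\<bar> \<le> 2 * pi * B"
proof -
  note [continuous_intros] = continuous_on_compose2[OF assms(1)]
  have B: "\<bar>f (cos z)\<bar> \<le> B" for z by (rule assms(2)) simp
  have bnd: "\<bar>u * v * w\<bar> \<le> B" if "\<bar>u\<bar> \<le> 1" "\<bar>v\<bar> \<le> 1" "\<bar>w\<bar> \<le> B" for u v w :: real
    using abs_prod3_le[of u 1 v w B] that by simp
  have "norm (integral {-pi..pi} (\<lambda>s. - (sin (real m * s) * sin s) * f (cos (\<theta> - s)))) \<le> B * (pi - - pi)"
    by (rule integral_bound_interval)
      (use bnd[of "sin (real m * s)" "sin s" "f (cos (\<theta> - s))" for s] B
        in \<open>auto intro!: continuous_intros simp: abs_mult\<close>)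
  then show "\<bar>x_moment m f \<theta>\<bar> \<le> 2 * pi * B"
    unfolding x_moment_def by (simp add: algebra_simps)
  have "norm (integral {-pi..pi} (\<lambda>s. sin (real m * s) * cos s * f (cos (\<theta> - s)))) \<le> B * (pi - - pi)"
    by (rule integral_bound_interval)
      (use bnd[of "sin (real m * s)" "cos s" "f (cos (\<theta> - s))" for s] B
        in \<open>auto intro!: continuous_intros simp: abs_mult\<close>)
  then show "\<bar>y_moment m f \<theta>\<bar> \<le> 2 * pi * B"
    unfolding y_moment_def by (simp add: algebra_simps)
qed

text \<open>The constant is 1 + 1 + 2 * 2: two products, and two projections of at most
  \<open>2 * B\<close> and \<open>2 * B'\<close>.\<close>

lemma transverse_bound:
  assumes "\<bar>x\<bar> \<le> B" "\<bar>y\<bar> \<le> B" "\<bar>x'\<bar> \<le> B'" "\<bar>y'\<bar> \<le> B'"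
  shows "\<bar>transverse \<phi> \<theta> x y x' y'\<bar> \<le> 6 * B * B'"
proof -
  have *: "\<bar>u * cos \<theta> + v * sin \<theta>\<bar> \<le> 2 * C" if "\<bar>u\<bar> \<le> C" "\<bar>v\<bar> \<le> C" for u v C
  proof -
    have "\<bar>u * cos \<theta>\<bar> \<le> C * 1" "\<bar>v * sin \<theta>\<bar> \<le> C * 1"
      unfolding abs_mult by (intro mult_mono; use that in auto)+
    then show ?thesis by linarith
  qed
  have "\<bar>(sin \<phi>)\<^sup>2 * (x * cos \<theta> + y * sin \<theta>) * (x' * cos \<theta> + y' * sin \<theta>)\<bar> \<le> 1 * (2 * B) * (2 * B')"
    unfolding abs_mult
    by (intro mult_mono *) (use assms in \<open>auto simp: abs_square_le_1\<close>)
  moreover have "\<bar>x * x'\<bar> \<le> B * B'" "\<bar>y * y'\<bar> \<le> B * B'"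
    unfolding abs_mult by (intro mult_mono; use assms in auto)+
  ultimately show ?thesis unfolding transverse_def by linarith
qed

text \<open>Polarised flux density: for \<open>f = g\<close> equal to the cosine of the phase it is,
  up to constants, \<open>sin \<phi>\<close> times j . j - (j . n)^2. The arguments \<open>f\<close>
  and \<open>g\<close> are kept apart so that each can be expanded in its own series. The argument
  \<open>sin \<phi> * cos (\<theta> - s)\<close> at which they are evaluated is the inner product of
  the normal with the source point.\<close>

definition flux_form :: "nat \<Rightarrow> (real \<Rightarrow> real) \<Rightarrow> (real \<Rightarrow> real) \<Rightarrow> real \<Rightarrow> real \<Rightarrow> real" where
  "flux_form m f g \<phi> \<theta> = sin \<phi> * transverse \<phi> \<theta>
     (x_moment m (\<lambda>u. f (sin \<phi> * u)) \<theta>) (y_moment m (\<lambda>u. f (sin \<phi> * u)) \<theta>)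
     (x_moment m (\<lambda>u. g (sin \<phi> * u)) \<theta>) (y_moment m (\<lambda>u. g (sin \<phi> * u)) \<theta>)"

lemma continuous_on_flux_form:
  assumes "continuous_on UNIV f" "continuous_on UNIV g"
  shows "continuous_on UNIV (\<lambda>z. flux_form m f g (fst z) (snd z))"
  unfolding flux_form_def transverse_def
  using continuous_on_moment[OF assms(1), of m 1] continuous_on_moment[OF assms(2), of m 1]
  by (auto intro!: continuous_intros)

text \<open>The constant is 6 from \<open>transverse_bound\<close> times
  \<open>(2 * pi)\<^sup>2\<close> from the two moment bounds.\<close>

lemma flux_form_bound:
  assumes "continuous_on UNIV f" "continuous_on UNIV g"
    and "\<And>u. \<bar>u\<bar> \<le> 1 \<Longrightarrow> \<bar>f u\<bar> \<le> B" "\<And>u. \<bar>u\<bar> \<le> 1 \<Longrightarrow> \<bar>g u\<bar> \<le> B'"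
  shows "\<bar>flux_form m f g \<phi> \<theta>\<bar> \<le> 24 * pi\<^sup>2 * (B * B')"
proof -
  have le1: "\<bar>sin \<phi> * u\<bar> \<le> 1" if "\<bar>u\<bar> \<le> 1" for u
    using that by (simp add: abs_mult mult_le_one)
  have c: "continuous_on UNIV (\<lambda>u. f (sin \<phi> * u))" "continuous_on UNIV (\<lambda>u. g (sin \<phi> * u))"
    by (auto intro!: continuous_on_compose2[OF assms(1)] continuous_on_compose2[OF assms(2)]
      continuous_intros)
  have "\<bar>transverse \<phi> \<theta>
     (x_moment m (\<lambda>u. f (sin \<phi> * u)) \<theta>) (y_moment m (\<lambda>u. f (sin \<phi> * u)) \<theta>)
     (x_moment m (\<lambda>u. g (sin \<phi> * u)) \<theta>) (y_moment m (\<lambda>u. g (sin \<phi> * u)) \<theta>)\<bar>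
     \<le> 6 * (2 * pi * B) * (2 * pi * B')"
    by (intro transverse_bound moment_bound c assms(3,4) le1)
  then have "1 * \<bar>transverse \<phi> \<theta>
     (x_moment m (\<lambda>u. f (sin \<phi> * u)) \<theta>) (y_moment m (\<lambda>u. f (sin \<phi> * u)) \<theta>)
     (x_moment m (\<lambda>u. g (sin \<phi> * u)) \<theta>) (y_moment m (\<lambda>u. g (sin \<phi> * u)) \<theta>)\<bar>
     \<le> 24 * pi\<^sup>2 * (B * B')"
    by (simp add: power2_eq_square algebra_simps)
  then show ?thesis
    unfolding flux_form_def abs_mult
    by (rule order_trans[rotated]) (intro mult_right_mono; simp)
qed

lemma moment_cmult:
  "x_moment m (\<lambda>u. k * f u) \<theta> = k * x_moment m f \<theta>"
  "y_moment m (\<lambda>u. k * f u) \<theta> = k * y_moment m f \<theta>"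
  unfolding x_moment_def y_moment_def
  by (simp_all only: integral_mult_right[symmetric] mult.left_commute[of _ k])

lemma sums_moment:
  assumes "\<And>n. continuous_on UNIV (f n)" "\<And>n u. \<bar>u\<bar> \<le> 1 \<Longrightarrow> \<bar>f n u\<bar> \<le> M n" "summable M"
    and "\<And>u. \<bar>u\<bar> \<le> 1 \<Longrightarrow> (\<lambda>n. f n u) sums g u"
  shows "(\<lambda>n. x_moment m (f n) \<theta>) sums x_moment m g \<theta>"
    and "(\<lambda>n. y_moment m (f n) \<theta>) sums y_moment m g \<theta>"
proof -
  note [continuous_intros] = continuous_on_compose2[OF assms(1)]
  have bnd: "\<bar>u * v * w\<bar> \<le> B" if "\<bar>u\<bar> \<le> 1" "\<bar>v\<bar> \<le> 1" "\<bar>w\<bar> \<le> B" for u v w B :: real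
    using abs_prod3_le[of u 1 v w B] that by simp
  show "(\<lambda>n. x_moment m (f n) \<theta>) sums x_moment m g \<theta>"
    unfolding x_moment_def cbox_interval[symmetric]
    by (rule sums_integral_cbox[OF _ _ assms(3)])
      (use assms(2) bnd[of "sin (real m * s)" "sin s" for s] in
        \<open>auto intro!: continuous_intros sums_mult assms(4) sums_minus simp: abs_mult\<close>)
  show "(\<lambda>n. y_moment m (f n) \<theta>) sums y_moment m g \<theta>"
    unfolding y_moment_def cbox_interval[symmetric]
    by (rule sums_integral_cbox[OF _ _ assms(3)])
      (use assms(2) bnd[of "sin (real m * s)" "cos s" for s] in
        \<open>auto intro!: continuous_intros sums_mult assms(4) sums_minus simp: abs_mult\<close>)
qed

lemma flux_form_commute: "flux_form m f g \<phi> \<theta> = flux_form m g f \<phi> \<theta>"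
  unfolding flux_form_def by (subst transverse_commute) simp

lemma sums_flux_form:
  assumes f: "\<And>n. continuous_on UNIV (f n)" "\<And>n u. \<bar>u\<bar> \<le> 1 \<Longrightarrow> \<bar>f n u\<bar> \<le> M n" "summable M"
    and "\<And>u. \<bar>u\<bar> \<le> 1 \<Longrightarrow> (\<lambda>n. f n u) sums g u"
  shows "(\<lambda>n. flux_form m k (f n) \<phi> \<theta>) sums flux_form m k g \<phi> \<theta>"
proof -
  have le1: "\<bar>sin \<phi> * u\<bar> \<le> 1" if "\<bar>u\<bar> \<le> 1" for u
    using that by (simp add: abs_mult mult_le_one)
  have c: "continuous_on UNIV (\<lambda>u. f n (sin \<phi> * u))" for n
    by (auto intro!: continuous_on_compose2[OF assms(1)] continuous_intros)
  note s = sums_moment[where f = "\<lambda>n u. f n (sin \<phi> * u)" and g = "\<lambda>u. g (sin \<phi> * u)",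
      OF c f(2)[OF le1] f(3) assms(4)[OF le1], of m \<theta>]
  show ?thesis
    unfolding flux_form_def transverse_def
    by (intro sums_mult sums_diff sums_add s sums_mult2)
qed

text \<open>Second argument first, then the first one, matching the order in
  \<open>iter_summable\<close>. The majorants are multiples of \<open>M k * M n\<close> for the
  inner series and of \<open>M n * B\<close> for the outer one, so no rearrangement of a double
  series is involved.\<close>

lemma flux_form_iterated_sums:
  assumes f: "\<And>n. continuous_on UNIV (f n)" "\<And>n u. \<bar>u\<bar> \<le> 1 \<Longrightarrow> \<bar>f n u\<bar> \<le> M n" "summable M"
    and s: "\<And>u. \<bar>u\<bar> \<le> 1 \<Longrightarrow> (\<lambda>n. f n u) sums g u"
    and g: "continuous_on UNIV g" "\<And>u. \<bar>u\<bar> \<le> 1 \<Longrightarrow> \<bar>g u\<bar> \<le> B"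
  shows "(\<lambda>n. iint (flux_form m (f k) (f n))) sums iint (flux_form m (f k) g)"
    and "(\<lambda>k. iint (flux_form m (f k) g)) sums iint (flux_form m g g)"
proof -
  show "(\<lambda>n. iint (flux_form m (f k) (f n))) sums iint (flux_form m (f k) g)"
  proof (rule sums_iint)
    show "\<bar>flux_form m (f k) (f n) \<phi> \<theta>\<bar> \<le> 24 * pi\<^sup>2 * (M k * M n)" for n \<phi> \<theta>
      by (intro flux_form_bound f)
    show "summable (\<lambda>n. 24 * pi\<^sup>2 * (M k * M n))"
      by (intro summable_mult f)
  qed (intro continuous_on_flux_form f g sums_flux_form[OF f s]; assumption)+
  show "(\<lambda>k. iint (flux_form m (f k) g)) sums iint (flux_form m g g)"
  proof (rule sums_iint)
    show "\<bar>flux_form m (f n) g \<phi> \<theta>\<bar> \<le> 24 * pi\<^sup>2 * (M n * B)" for n \<phi> \<theta>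
      by (intro flux_form_bound f g)
    show "summable (\<lambda>n. 24 * pi\<^sup>2 * (M n * B))"
      by (intro summable_mult summable_mult2 f)
    show "(\<lambda>k. flux_form m (f k) g \<phi> \<theta>) sums flux_form m g g \<phi> \<theta>" for \<phi> \<theta>
    proof -
      have "(\<lambda>k. flux_form m (f k) g \<phi> \<theta>) = (\<lambda>k. flux_form m g (f k) \<phi> \<theta>)"
        by (intro ext flux_form_commute)
      then show ?thesis using sums_flux_form[OF f s, of m g] by simp
    qed
  qed (intro continuous_on_flux_form f g)+
qed

text \<open>By homogeneity \<open>sin \<phi> ^ p\<close> leaves the moments of the monomials and
  joins the area factor \<open>sin \<phi>\<close>.\<close>

lemma iint_flux_form_power:
  "iint (flux_form m (\<lambda>u. a * u ^ p) (\<lambda>u. b * u ^ p')) = - (a * b * 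
    (\<Sum>s\<in>odd_idx m. \<Sum>s'\<in>odd_idx m. (-1) ^ ((s - 1) div 2) * real (m choose s) *
        ((-1) ^ ((s' - 1) div 2) * real (m choose s')) * flux_coeff p p' s s' m))"
proof -
  let ?g = "\<lambda>\<phi> \<theta>. sin \<phi> ^ (p+p'+1) *
      transverse \<phi> \<theta> (x_moment m (\<lambda>z. z ^ p) \<theta>) (y_moment m (\<lambda>z. z ^ p) \<theta>)
        (x_moment m (\<lambda>z. z ^ p') \<theta>) (y_moment m (\<lambda>z. z ^ p') \<theta>)"
  have "(\<lambda>u. a * (k * u) ^ p) = (\<lambda>u. (a * k ^ p) * u ^ p)" for a k :: real and p
    by (simp add: power_mult_distrib mult.assoc)
  note * = this moment_cmult[of m "a * k ^ p" "\<lambda>u. u ^ p" for a k p]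
  have "flux_form m (\<lambda>u. a * u ^ p) (\<lambda>u. b * u ^ p') = (\<lambda>\<phi> \<theta>. a * b * ?g \<phi> \<theta>)"
    unfolding flux_form_def * by (intro ext) (simp add: transverse_def power_add algebra_simps)
  moreover have "iint (\<lambda>\<phi> \<theta>. a * b * ?g \<phi> \<theta>) = a * b * iint ?g"
    unfolding iint_def by (simp only: integral_mult_right)
  ultimately show ?thesis unfolding iint_moment_power by simp
qed

section \<open>Far field estimates\<close>

lemma circ_axis: "circ s = cos s *\<^sub>R axis 1 1 + sin s *\<^sub>R axis 2 1"
  by (simp add: circ_def vec_eq_iff forall_3 axis_def)

lemma circ_tangent_axis: "circ_tangent s = (- sin s) *\<^sub>R axis 1 1 + cos s *\<^sub>R axis 2 1"
  by (simp add: circ_tangent_def vec_eq_iff forall_3 axis_def)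

lemma sph_normal_axis:
  "sph_normal \<phi> \<theta> =
    (sin \<phi> * cos \<theta>) *\<^sub>R axis 1 1 + (sin \<phi> * sin \<theta>) *\<^sub>R axis 2 1 + cos \<phi> *\<^sub>R axis 3 1"
  by (simp add: sph_normal_def vec_eq_iff forall_3 axis_def)

lemma norm_circ [simp]: "norm (circ s) = 1"
  by (simp add: norm_eq_1 circ_def inner_vec_def sum_3 flip: power2_eq_square)

lemma norm_circ_tangent [simp]: "norm (circ_tangent s) = 1"
  by (simp add: norm_eq_1 circ_tangent_def inner_vec_def sum_3 flip: power2_eq_square)

lemma inner_sph_normal_circ: "sph_normal \<phi> \<theta> \<bullet> circ s = sin \<phi> * cos (\<theta> - s)"
  by (simp add: circ_def sph_normal_def inner_vec_def sum_3 cos_diff algebra_simps)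

lemma norm_sph_normal [simp]: "norm (sph_normal \<phi> \<theta>) = 1"
proof -
  have "sph_normal \<phi> \<theta> \<bullet> sph_normal \<phi> \<theta> = (sin \<phi>)\<^sup>2 * (cos \<theta>)\<^sup>2 + (sin \<phi>)\<^sup>2 * (sin \<theta>)\<^sup>2 + (cos \<phi>)\<^sup>2"
    by (simp add: sph_normal_def inner_vec_def sum_3 power2_eq_square algebra_simps)
  then show ?thesis by (simp add: norm_eq_1 flip: distrib_left)
qed

lemma continuous_on_axis_curves [continuous_intros]:
  fixes f g :: "'a::t2_space \<Rightarrow> real"
  shows "continuous_on S f \<Longrightarrow> continuous_on S (\<lambda>x. circ (f x))"
  "continuous_on S f \<Longrightarrow> continuous_on S (\<lambda>x. circ_tangent (f x))"
  "continuous_on S f \<Longrightarrow> continuous_on S g \<Longrightarrow> continuous_on S (\<lambda>x. sph_normal (f x) (g x))"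
  unfolding circ_axis circ_tangent_axis sph_normal_axis by (auto intro!: continuous_intros)

lemma norm_cross_le: "norm (x \<times> y) \<le> norm x * norm y"
proof (rule power2_le_imp_le)
  show "(norm (x \<times> y))\<^sup>2 \<le> (norm x * norm y)\<^sup>2"
    using norm_cross_dot[of x y] zero_le_power2[of "x \<bullet> y"] by linarith
qed simp

section \<open>The integrands of the fields with the time derivatives carried out\<close>

definition E_integrand :: "real \<Rightarrow> nat \<Rightarrow> real ^ 3 \<Rightarrow> real \<Rightarrow> real \<Rightarrow> real ^ 3" where
  "E_integrand c m x t s =
     (cos (real m * s) * cos (real m * ret_time c x t s) / (sep x s)\<^sup>2) *\<^sub>R sep_dir x s
   + (- (real m * cos (real m * s) * sin (real m * ret_time c x t s)) / (c * sep x s)) *\<^sub>R sep_dir x s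
   - (1 / (c\<^sup>2 * sep x s)) *\<^sub>R ((real m * sin (real m * s) * cos (real m * ret_time c x t s)) *\<^sub>R circ_tangent s)"

definition B_integrand :: "real \<Rightarrow> nat \<Rightarrow> real ^ 3 \<Rightarrow> real \<Rightarrow> real \<Rightarrow> real ^ 3" where
  "B_integrand c m x t s =
     ((1 / (sep x s)\<^sup>2) *\<^sub>R ((sin (real m * s) * sin (real m * ret_time c x t s)) *\<^sub>R circ_tangent s)
   + (1 / (c * sep x s)) *\<^sub>R ((real m * sin (real m * s) * cos (real m * ret_time c x t s)) *\<^sub>R circ_tangent s))
     \<times> sep_dir x s"

lemma deriv_rho_m: "deriv (rho_m m s) t = - (real m * cos (real m * s) * sin (real m * t))"
  unfolding rho_m_def
  by (rule DERIV_imp_deriv) (auto intro!: derivative_eq_intros)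

lemma vector_derivative_J_m:
  "vector_derivative (J_m m s) (at t) = (real m * sin (real m * s) * cos (real m * t)) *\<^sub>R circ_tangent s"
  unfolding J_m_def
  by (rule vector_derivative_at)
    (auto intro!: derivative_eq_intros simp: has_real_derivative_iff_has_vector_derivative[symmetric])

lemma E_m_integrand:
  "E_m \<epsilon>0 c m x t = (1 / (4 * pi * \<epsilon>0)) *\<^sub>R integral {- pi..pi} (E_integrand c m x t)"
  unfolding E_m_def jefimenko_E_def Let_def deriv_rho_m vector_derivative_J_m
  unfolding E_integrand_def rho_m_def J_m_def ..

lemma B_m_integrand:
  "B_m \<mu>0 c m x t = (\<mu>0 / (4 * pi)) *\<^sub>R integral {- pi..pi} (B_integrand c m x t)"
  unfolding B_m_def jefimenko_B_def Let_def deriv_rho_m vector_derivative_J_m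
  unfolding B_integrand_def rho_m_def J_m_def ..

lemma sep_pos: "1 < norm x \<Longrightarrow> 0 < sep x s"
  unfolding sep_def using norm_circ[of s] by fastforce

text \<open>Outside the closed unit ball the distance to the source never vanishes. Joint continuity
  in both arguments makes the fields continuous in \<open>x\<close>, as integration over the sphere
  requires.\<close>

lemma continuous_on_integrands:
  assumes "c > 0"
  shows "continuous_on (Sigma {x. 1 < norm x} (\<lambda>_. UNIV)) (\<lambda>(x, s). E_integrand c m x t s)"
    and "continuous_on (Sigma {x. 1 < norm x} (\<lambda>_. UNIV)) (\<lambda>(x, s). B_integrand c m x t s)"
proof -
  let ?S = "Sigma {x::real^3. 1 < norm x} (\<lambda>_. UNIV :: real set)"
  have c: "c \<noteq> 0" using assms by simp
  have sep: "continuous_on ?S (\<lambda>z. sep (fst z) (snd z))"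
    unfolding sep_def by (intro continuous_intros)
  have nz: "\<forall>z\<in>?S. sep (fst z) (snd z) \<noteq> 0"
    using sep_pos by (auto simp: less_imp_neq[THEN not_sym])
  have nz': "\<forall>z\<in>?S. c * sep (fst z) (snd z) \<noteq> 0" "\<forall>z\<in>?S. c\<^sup>2 * sep (fst z) (snd z) \<noteq> 0"
     "\<forall>z\<in>?S. (sep (fst z) (snd z))\<^sup>2 \<noteq> 0" "\<forall>z\<in>?S. c \<noteq> 0"
    using nz c by simp_all
  have ret: "continuous_on ?S (\<lambda>z. ret_time c (fst z) t (snd z))"
    unfolding ret_time_def by (intro continuous_intros sep nz')
  have dir: "continuous_on ?S (\<lambda>z. sep_dir (fst z) (snd z))"
    unfolding sep_dir_def by (intro continuous_intros sep nz)
  show "continuous_on ?S (\<lambda>(x, s). E_integrand c m x t s)"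
    unfolding E_integrand_def case_prod_unfold by (intro continuous_intros sep ret dir nz')
  show "continuous_on ?S (\<lambda>(x, s). B_integrand c m x t s)"
    unfolding B_integrand_def case_prod_unfold by (intro continuous_intros continuous_on_cross sep ret dir nz')
qed

lemma continuous_on_fields:
  assumes "c > 0"
  shows "continuous_on {x. 1 < norm x} (\<lambda>x. E_m \<epsilon>0 c m x t)"
    and "continuous_on {x. 1 < norm x} (\<lambda>x. B_m \<mu>0 c m x t)"
  unfolding E_m_integrand B_m_integrand cbox_interval[symmetric]
  by (intro continuous_intros integral_continuous_on_param
      continuous_on_subset[OF continuous_on_integrands(1)[OF assms]]
      continuous_on_subset[OF continuous_on_integrands(2)[OF assms]]; auto)+

section \<open>Pointwise far field approximation\<close>

text \<open>All constants come from \<open>\<bar>d - r\<bar> \<le> 1\<close> and r <= R <= r + 1.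
  These give |d - R| <= 2 and 1/d <= 3/R, whence both constants 6 arise as 2 * 3.\<close>

lemma sep_estimates:
  fixes n p :: "real ^ 3"
  assumes r: "r \<ge> 2" and n: "norm n = 1" and p: "norm p = 1"
    and R: "R = sqrt (r\<^sup>2 + 1)" and u: "R * u = r * (n \<bullet> p)" and d: "d = norm (r *\<^sub>R n - p)"
  shows "R / 3 \<le> d" "0 < R" "\<bar>1 / d - 1 / R\<bar> \<le> 6 / R\<^sup>2" "\<bar>d - (R - u)\<bar> \<le> 1 / R"
    "norm ((1 / d) *\<^sub>R (r *\<^sub>R n - p) - n) \<le> 6 / R"
proof -
  have R2: "R\<^sup>2 = r\<^sup>2 + 1" unfolding R by simp
  have rR: "r \<le> R" unfolding R using r by (intro real_le_rsqrt) simp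
  have Rr: "R \<le> r + 1" unfolding R using r by (intro real_le_lsqrt) (auto simp: power2_eq_square algebra_simps)
  show Rpos: "0 < R" using rR r by linarith
  have nr: "norm (r *\<^sub>R n) = r" using n r by simp
  have dr: "\<bar>d - r\<bar> \<le> 1" using norm_triangle_ineq3[of "r *\<^sub>R n - p" "r *\<^sub>R n"] p nr by (simp add: d)
  \<comment> \<open>Here r >= 2 is the exact threshold for r - 1 >= (r + 1) / 3.\<close>
  show d3: "R / 3 \<le> d" using dr Rr r by linarith
  then have dpos: "0 < d" using Rpos by linarith
  have dR: "\<bar>d - R\<bar> \<le> 2" using dr rR Rr by linarith
  have d_inv: "1 / d \<le> 3 / R" using d3 dpos Rpos by (simp add: field_simps)
  have "\<bar>1 / d - 1 / R\<bar> = \<bar>d - R\<bar> * ((1 / d) * (1 / R))"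
    using dpos Rpos by (simp add: field_simps abs_mult abs_divide abs_minus_commute)
  also have "\<dots> \<le> 2 * ((3 / R) * (1 / R))"
    by (intro mult_mono dR d_inv) (use Rpos dpos in auto)
  finally show "\<bar>1 / d - 1 / R\<bar> \<le> 6 / R\<^sup>2" by (simp add: power2_eq_square)
  have np: "\<bar>n \<bullet> p\<bar> \<le> 1" using Cauchy_Schwarz_ineq2[of n p] n p by simp
  have "R * \<bar>u\<bar> = r * \<bar>n \<bullet> p\<bar>" using arg_cong[OF u, of abs] Rpos r by (simp add: abs_mult)
  also have "\<dots> \<le> R * 1" using rR r np by (intro mult_mono) auto
  finally have u1: "\<bar>u\<bar> \<le> 1" using Rpos by simp
  have "d\<^sup>2 = r\<^sup>2 * (n \<bullet> n) - 2 * (r * (n \<bullet> p)) + p \<bullet> p"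
    unfolding d power2_norm_eq_inner by (simp add: inner_diff inner_commute power2_eq_square algebra_simps)
  then have "d\<^sup>2 = R\<^sup>2 - 2 * (R * u)" using n p by (simp add: R2 u norm_eq_1)
  \<comment> \<open>Completing the square: the distance differs from \<open>R - u\<close> only by
    the quotient of \<open>u\<^sup>2\<close> by a quantity of size at least
    \<open>R\<close>.\<close>
  then have "(d - (R - u)) * (d + (R - u)) = - u\<^sup>2" by (simp add: power2_eq_square algebra_simps)
  then have "\<bar>d - (R - u)\<bar> * \<bar>d + (R - u)\<bar> = u\<^sup>2" by (metis abs_mult abs_minus_cancel abs_power2)
  \<comment> \<open>Since d >= r - 1 >= 1 >= u.\<close>
  moreover have "R \<le> \<bar>d + (R - u)\<bar>" using dr r u1 by linarith
  ultimately have "\<bar>d - (R - u)\<bar> * R \<le> u\<^sup>2" by (metis abs_ge_zero mult_left_mono)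
  also have "u\<^sup>2 \<le> 1" using u1 by (simp add: abs_square_le_1)
  finally show "\<bar>d - (R - u)\<bar> \<le> 1 / R" using Rpos by (simp add: field_simps)
  have "(1 / d) *\<^sub>R (r *\<^sub>R n - p) - n = (1 / d) *\<^sub>R ((r - d) *\<^sub>R n - p)"
    using dpos by (simp add: algebra_simps)
  also have "norm \<dots> \<le> (1 / d) * (\<bar>r - d\<bar> * 1 + 1)"
    using dpos n p norm_triangle_ineq4[of "(r - d) *\<^sub>R n" p]
    by (auto simp: divide_simps intro: order_trans)
  also have "\<dots> \<le> (3 / R) * 2"
    using dr d_inv dpos Rpos by (intro mult_mono) auto
  finally show "norm ((1 / d) *\<^sub>R (r *\<^sub>R n - p) - n) \<le> 6 / R" by simp
qed

lemma abs_sin_diff_le: "\<bar>sin x - sin y\<bar> \<le> \<bar>x - y\<bar>" for x y :: real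
proof -
  have "\<bar>sin x - sin y\<bar> = 2 * \<bar>sin ((x - y) / 2)\<bar> * \<bar>cos ((x + y) / 2)\<bar>"
    by (simp add: sin_diff_sin abs_mult)
  also have "\<dots> \<le> 2 * \<bar>(x - y) / 2\<bar> * 1"
    by (intro mult_mono abs_sin_x_le_abs_x) auto
  finally show ?thesis by simp
qed

lemma abs_cos_diff_le: "\<bar>cos x - cos y\<bar> \<le> \<bar>x - y\<bar>" for x y :: real
  using abs_sin_diff_le[of "pi / 2 - x" "pi / 2 - y"]
  by (simp add: sin_diff abs_minus_commute)

text \<open>Split f/d - f0/R = (f - f0)/d + f0 (1/d - 1/R); the first term uses 1/d <= 3/R.\<close>

lemma quotient_estimate:
  fixes f f0 d R F e :: real
  assumes "0 < R" "R / 3 \<le> d" "\<bar>1 / d - 1 / R\<bar> \<le> 6 / R\<^sup>2" "\<bar>f - f0\<bar> \<le> e / R" "\<bar>f0\<bar> \<le> F"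
  shows "\<bar>f / d - f0 / R\<bar> \<le> (3 * e + 6 * F) / R\<^sup>2"
proof -
  have d: "0 < d" "1 / d \<le> 3 / R" using assms(1,2) by (auto simp: field_simps intro: less_le_trans)
  have "f / d - f0 / R = (f - f0) * (1 / d) + f0 * (1 / d - 1 / R)"
    by (simp add: algebra_simps diff_divide_distrib)
  also have "\<bar>\<dots>\<bar> \<le> \<bar>f - f0\<bar> * (1 / d) + \<bar>f0\<bar> * \<bar>1 / d - 1 / R\<bar>"
    using d by (intro order_trans[OF abs_triangle_ineq]) (simp add: abs_mult)
  also have "\<dots> \<le> (e / R) * (3 / R) + F * (6 / R\<^sup>2)"
    by (intro add_mono mult_mono assms d) (use assms d in auto)
  finally show ?thesis by (simp add: power2_eq_square add_divide_distrib algebra_simps)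
qed

lemma norm_scale_diff:
  "norm (a *\<^sub>R v - b *\<^sub>R w) \<le> \<bar>a - b\<bar> * norm v + \<bar>b\<bar> * norm (v - w)"
  for v w :: "'a::real_normed_vector"
proof -
  have "a *\<^sub>R v - b *\<^sub>R w = (a - b) *\<^sub>R v + b *\<^sub>R (v - w)" by (simp add: algebra_simps)
  then show ?thesis by (metis norm_scaleR norm_triangle_ineq)
qed

text \<open>\<open>m\<close> times the retarded time with the distance replaced by \<open>R - (r / R) u\<close>.\<close>

definition far_phase :: "real \<Rightarrow> nat \<Rightarrow> real \<Rightarrow> real \<Rightarrow> real \<Rightarrow> real" where
  "far_phase c m r t u = real m * (t - sqrt (r\<^sup>2 + 1) / c) + real m / c * (r / sqrt (r\<^sup>2 + 1)) * u"

text \<open>The terms with the inverse square of the distance are dropped, the distance in the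
  denominators becomes \<open>R\<close> and the direction becomes the normal; the phase keeps its
  dependence on the source point.\<close>

definition E_far :: "real \<Rightarrow> nat \<Rightarrow> real \<Rightarrow> real \<Rightarrow> real \<Rightarrow> real \<Rightarrow> real \<Rightarrow> real ^ 3" where
  "E_far c m r t \<phi> \<theta> s =
    (- (real m * cos (real m * s) * sin (far_phase c m r t (sin \<phi> * cos (\<theta> - s))))
       / (c * sqrt (r\<^sup>2 + 1))) *\<^sub>R sph_normal \<phi> \<theta>
    - (real m * sin (real m * s) * cos (far_phase c m r t (sin \<phi> * cos (\<theta> - s)))
       / (c\<^sup>2 * sqrt (r\<^sup>2 + 1))) *\<^sub>R circ_tangent s"

definition B_far :: "real \<Rightarrow> nat \<Rightarrow> real \<Rightarrow> real \<Rightarrow> real \<Rightarrow> real \<Rightarrow> real \<Rightarrow> real ^ 3" where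
  "B_far c m r t \<phi> \<theta> s =
    (real m * sin (real m * s) * cos (far_phase c m r t (sin \<phi> * cos (\<theta> - s)))
       / (c * sqrt (r\<^sup>2 + 1))) *\<^sub>R (circ_tangent s \<times> sph_normal \<phi> \<theta>)"

text \<open>The phase error is m/c times the distance error, and sine and cosine are 1-Lipschitz;
  \<open>quotient_estimate\<close> with e = m (m/c) and F = m then yields \<open>k\<close>. The 9 is
  from 1/d^2 <= 9/R^2 for the dropped terms, and 6 m/c is the direction error 6/R times the
  amplitude (m/c)/R.\<close>

lemma integrand_estimates:
  fixes c r t \<phi> \<theta> s :: real and m :: nat
  assumes c: "c > 0" and r: "r \<ge> 2"
  defines "R \<equiv> sqrt (r\<^sup>2 + 1)"
  defines "k \<equiv> 3 * (real m * (real m / c)) + 6 * real m"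
  shows "norm (E_integrand c m (r *\<^sub>R sph_normal \<phi> \<theta>) t s - E_far c m r t \<phi> \<theta> s)
           \<le> (9 + k / c + 6 * (real m / c) + k / c\<^sup>2) / R\<^sup>2" (is ?E)
    and "norm (B_integrand c m (r *\<^sub>R sph_normal \<phi> \<theta>) t s - B_far c m r t \<phi> \<theta> s)
           \<le> (9 + k / c + 6 * (real m / c)) / R\<^sup>2" (is ?B)
    and "norm (E_far c m r t \<phi> \<theta> s) \<le> (real m / c + real m / c\<^sup>2) / R" (is ?FE)
    and "norm (B_far c m r t \<phi> \<theta> s) \<le> (real m / c) / R" (is ?FB)
proof -
  define n p d u where "n = sph_normal \<phi> \<theta>" and "p = circ s" and "d = sep (r *\<^sub>R n) s"
    and "u = r * (n \<bullet> p) / R"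
  define T \<psi> where "T = real m * ret_time c (r *\<^sub>R n) t s"
    and "\<psi> = far_phase c m r t (sin \<phi> * cos (\<theta> - s))"
  define dh where "dh = sep_dir (r *\<^sub>R n) s"
  define \<tau> where "\<tau> = circ_tangent s"
  have R0: "R > 0" unfolding R_def by (auto intro: add_nonneg_pos)
  have n: "norm n = 1" "norm p = 1" "norm \<tau> = 1" by (simp_all add: n_def p_def \<tau>_def)
  have d_eq: "d = norm (r *\<^sub>R n - p)" by (simp add: d_def p_def sep_def)
  have "R * u = r * (n \<bullet> p)" using R0 by (simp add: u_def)
  note est = sep_estimates[OF r n(1,2) R_def[THEN meta_eq_to_obj_eq] this d_eq]
  have d0: "d > 0" "1 / d \<le> 3 / R" using est(1) R0 by (auto simp: field_simps intro: less_le_trans)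
  have dh: "dh = (1 / d) *\<^sub>R (r *\<^sub>R n - p)" by (simp add: dh_def sep_dir_def d_def p_def)
  have dh1: "norm dh = 1" using d0 by (simp add: dh flip: d_eq)
  have dhn: "norm (dh - n) \<le> 6 / R" using est(5) by (simp add: dh)
  have u_eq: "real m / c * (r / R) * (sin \<phi> * cos (\<theta> - s)) = real m / c * u"
    by (simp add: u_def n_def p_def inner_sph_normal_circ)
  have "T - \<psi> = real m / c * ((R - u) - d)"
  proof -
    have "\<psi> = real m * (t - R / c) + real m / c * u"
      unfolding \<psi>_def far_phase_def R_def[symmetric] u_eq ..
    moreover have "T = real m * (t - d / c)"
      unfolding T_def ret_time_def d_def[symmetric] ..
    ultimately show ?thesis using c by (simp add: field_simps)
  qed
  then have "\<bar>T - \<psi>\<bar> = real m / c * \<bar>d - (R - u)\<bar>"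
    using c by (simp add: abs_mult abs_minus_commute)
  also have "\<dots> \<le> real m / c * (1 / R)"
    by (intro mult_left_mono est) (use c in auto)
  finally have T\<psi>: "\<bar>T - \<psi>\<bar> \<le> (real m / c) / R" by simp
  have sinT: "\<bar>sin T - sin \<psi>\<bar> \<le> (real m / c) / R" "\<bar>cos T - cos \<psi>\<bar> \<le> (real m / c) / R"
    using T\<psi> abs_sin_diff_le[of T \<psi>] abs_cos_diff_le[of T \<psi>] by linarith+
  define f f0 g g0 where "f = real m * cos (real m * s) * sin T"
    and "f0 = real m * cos (real m * s) * sin \<psi>"
    and "g = real m * sin (real m * s) * cos T"
    and "g0 = real m * sin (real m * s) * cos \<psi>"
  have "\<bar>f - f0\<bar> \<le> real m * ((real m / c) / R)"
    unfolding f_def f0_def right_diff_distrib[symmetric] by (intro abs_prod3_le sinT) auto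
  then have ff: "\<bar>f - f0\<bar> \<le> real m * (real m / c) / R" by simp
  have "\<bar>g - g0\<bar> \<le> real m * ((real m / c) / R)"
    unfolding g_def g0_def right_diff_distrib[symmetric] by (intro abs_prod3_le sinT) auto
  then have gg: "\<bar>g - g0\<bar> \<le> real m * (real m / c) / R" by simp
  have f0m: "\<bar>f0\<bar> \<le> real m" "\<bar>g0\<bar> \<le> real m"
    unfolding f0_def g0_def using abs_prod3_le[of "real m" "real m" _ _ 1] by auto
  have fq: "\<bar>f / d - f0 / R\<bar> \<le> k / R\<^sup>2" "\<bar>g / d - g0 / R\<bar> \<le> k / R\<^sup>2"
    unfolding k_def
    using quotient_estimate[OF R0 est(1,3) ff f0m(1)] quotient_estimate[OF R0 est(1,3) gg f0m(2)]
    by (simp_all add: mult.assoc)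
  have d2: "1 / d\<^sup>2 \<le> 9 / R\<^sup>2"
    using mult_mono[OF d0(2) d0(2)] R0 d0 by (simp add: power2_eq_square)
  have small: "norm ((a * b / d\<^sup>2) *\<^sub>R v) \<le> 9 / R\<^sup>2" if "\<bar>a\<bar> \<le> 1" "\<bar>b\<bar> \<le> 1" "norm v = 1" for a b and v :: "real^3"
  proof -
    have "\<bar>a\<bar> * \<bar>b\<bar> * (1 / d\<^sup>2) \<le> 1 * 1 * (9 / R\<^sup>2)"
      by (intro mult_mono d2 that) auto
    then show ?thesis using that by (simp add: abs_mult)
  qed
  have fc: "\<bar>f / (c * d) - f0 / (c * R)\<bar> \<le> (k / c) / R\<^sup>2"
    "\<bar>g / (c * d) - g0 / (c * R)\<bar> \<le> (k / c) / R\<^sup>2"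
    "\<bar>g / (c\<^sup>2 * d) - g0 / (c\<^sup>2 * R)\<bar> \<le> (k / c\<^sup>2) / R\<^sup>2"
  proof -
    have *: "\<bar>h / (q * d) - h0 / (q * R)\<bar> \<le> (k / q) / R\<^sup>2" if "\<bar>h / d - h0 / R\<bar> \<le> k / R\<^sup>2" "q > 0" for h h0 q
    proof -
      have "h / (q * d) - h0 / (q * R) = (h / d - h0 / R) / q"
        by (simp add: diff_divide_distrib mult.commute)
      then have "\<bar>h / (q * d) - h0 / (q * R)\<bar> = \<bar>h / d - h0 / R\<bar> / q" using that by simp
      also have "\<dots> \<le> (k / R\<^sup>2) / q" using that by (intro divide_right_mono) auto
      finally show ?thesis by (simp add: mult.commute)
    qed
    show "\<bar>f / (c * d) - f0 / (c * R)\<bar> \<le> (k / c) / R\<^sup>2"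
    "\<bar>g / (c * d) - g0 / (c * R)\<bar> \<le> (k / c) / R\<^sup>2"
    "\<bar>g / (c\<^sup>2 * d) - g0 / (c\<^sup>2 * R)\<bar> \<le> (k / c\<^sup>2) / R\<^sup>2"
      using c by (intro * fq; simp)+
  qed
  have b0: "\<bar>h / (q * R)\<bar> \<le> (real m / q) / R" if "\<bar>h\<bar> \<le> real m" "q > 0" for h q
    using that R0 by (simp add: abs_mult divide_right_mono)
  have E_eq: "E_integrand c m (r *\<^sub>R sph_normal \<phi> \<theta>) t s =
      (cos (real m * s) * cos T / d\<^sup>2) *\<^sub>R dh - (f / (c * d)) *\<^sub>R dh - (g / (c\<^sup>2 * d)) *\<^sub>R \<tau>"
    unfolding E_integrand_def n_def[symmetric] d_def[symmetric] T_def[symmetric] dh_def[symmetric]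
      \<tau>_def[symmetric] f_def[symmetric] g_def[symmetric]
    by simp
  have E0_eq: "E_far c m r t \<phi> \<theta> s = - (f0 / (c * R)) *\<^sub>R n - (g0 / (c\<^sup>2 * R)) *\<^sub>R \<tau>"
    unfolding E_far_def n_def[symmetric] R_def[symmetric] \<psi>_def[symmetric]
      \<tau>_def[symmetric] f0_def[symmetric] g0_def[symmetric] by simp
  have B_eq: "B_integrand c m (r *\<^sub>R sph_normal \<phi> \<theta>) t s =
      ((sin (real m * s) * sin T / d\<^sup>2) *\<^sub>R \<tau> + (g / (c * d)) *\<^sub>R \<tau>) \<times> dh"
    unfolding B_integrand_def n_def[symmetric] d_def[symmetric] T_def[symmetric] dh_def[symmetric]
      \<tau>_def[symmetric] f_def[symmetric] g_def[symmetric] by simp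
  have B0_eq: "B_far c m r t \<phi> \<theta> s = ((g0 / (c * R)) *\<^sub>R \<tau>) \<times> n"
    unfolding B_far_def n_def[symmetric] R_def[symmetric] \<psi>_def[symmetric]
      \<tau>_def[symmetric] g0_def[symmetric] by (simp add: cross_mult_left)
  have t1: "norm ((f / (c * d)) *\<^sub>R dh - (f0 / (c * R)) *\<^sub>R n) \<le> (k / c) / R\<^sup>2 + (real m / c) / R * (6 / R)"
    by (rule order_trans[OF norm_scale_diff], intro add_mono mult_mono)
      (use fc b0[OF f0m(1) c] dhn dh1 c R0 in auto)
  have t2: "norm ((g / (c\<^sup>2 * d)) *\<^sub>R \<tau> - (g0 / (c\<^sup>2 * R)) *\<^sub>R \<tau>) \<le> (k / c\<^sup>2) / R\<^sup>2"
    using fc(3) n(3) by (simp flip: scaleR_left_diff_distrib)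
  have "E_integrand c m (r *\<^sub>R sph_normal \<phi> \<theta>) t s - E_far c m r t \<phi> \<theta> s =
      (cos (real m * s) * cos T / d\<^sup>2) *\<^sub>R dh - ((f / (c * d)) *\<^sub>R dh - (f0 / (c * R)) *\<^sub>R n)
      - ((g / (c\<^sup>2 * d)) *\<^sub>R \<tau> - (g0 / (c\<^sup>2 * R)) *\<^sub>R \<tau>)"
    unfolding E_eq E0_eq by (simp add: algebra_simps)
  also have "norm \<dots> \<le> 9 / R\<^sup>2 + ((k / c) / R\<^sup>2 + (real m / c) / R * (6 / R)) + (k / c\<^sup>2) / R\<^sup>2"
    by (intro order_trans[OF norm_triangle_ineq4] add_mono t1 t2 small dh1) auto
  finally show ?E by (simp add: add_divide_distrib power2_eq_square mult_ac)
  let ?V = "(sin (real m * s) * sin T / d\<^sup>2) *\<^sub>R \<tau> + (g / (c * d)) *\<^sub>R \<tau>"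
  let ?W = "(g0 / (c * R)) *\<^sub>R \<tau>"
  have "?V \<times> dh - ?W \<times> n = (?V - ?W) \<times> dh + ?W \<times> (dh - n)"
    by (simp add: Cross3.left_diff_distrib Cross3.right_diff_distrib)
  also have "norm \<dots> \<le> norm (?V - ?W) * norm dh + norm ?W * norm (dh - n)"
    by (intro order_trans[OF norm_triangle_ineq] add_mono norm_cross_le)
  also have "\<dots> \<le> (9 / R\<^sup>2 + (k / c) / R\<^sup>2) * 1 + (real m / c) / R * (6 / R)"
  proof (intro add_mono mult_mono)
    have "?V - ?W = (sin (real m * s) * sin T / d\<^sup>2) *\<^sub>R \<tau> + (g / (c * d) - g0 / (c * R)) *\<^sub>R \<tau>"
      by (simp add: scaleR_left_diff_distrib)
    also have "norm \<dots> \<le> 9 / R\<^sup>2 + (k / c) / R\<^sup>2"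
      using fc(2) n(3) by (intro order_trans[OF norm_triangle_ineq] add_mono small) auto
    finally show "norm (?V - ?W) \<le> 9 / R\<^sup>2 + (k / c) / R\<^sup>2" .
    then show "0 \<le> 9 / R\<^sup>2 + (k / c) / R\<^sup>2" using norm_ge_zero order_trans by blast
    show "norm ?W \<le> (real m / c) / R" using b0[OF f0m(2) c] n(3) by simp
  qed (use dh1 dhn c R0 in auto)
  finally show ?B unfolding B_eq B0_eq by (simp add: add_divide_distrib power2_eq_square mult_ac)
  have "norm (E_far c m r t \<phi> \<theta> s) \<le> (real m / c) / R + (real m / c\<^sup>2) / R"
    unfolding E0_eq
    using b0[OF f0m(1) c] b0[OF f0m(2), of "c\<^sup>2"] c n
    by (intro order_trans[OF norm_triangle_ineq4] add_mono) auto
  then show ?FE by (simp add: add_divide_distrib)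
  have "norm (B_far c m r t \<phi> \<theta> s) \<le> norm ?W * norm n"
    unfolding B0_eq by (rule norm_cross_le)
  then show ?FB using b0[OF f0m(2) c] n by simp
qed

lemma continuous_on_far_phase [continuous_intros]:
  fixes f :: "'a::t2_space \<Rightarrow> real"
  shows "continuous_on S f \<Longrightarrow> continuous_on S (\<lambda>x. far_phase c m r t (f x))"
  unfolding far_phase_def by (intro continuous_intros)

section \<open>The radial flux density\<close>

text \<open>The part of E along \<open>n\<close> contributes n x (j x n), which is orthogonal to
  \<open>n\<close>; Lagrange's identity evaluates the rest.\<close>

lemma poynting_radial:
  fixes n j :: "real ^ 3"
  assumes "norm n = 1"
  shows "((a *\<^sub>R n - b *\<^sub>R j) \<times> (k *\<^sub>R (j \<times> n))) \<bullet> n = k * b * (j \<bullet> j - (j \<bullet> n)\<^sup>2)"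
proof -
  have "n \<bullet> n = 1" using assms by (simp add: norm_eq_1)
  then show ?thesis
    by (simp add: cross_mult_right Lagrange inner_diff inner_commute power2_eq_square algebra_simps)
qed

lemma far_flux_density:
  fixes c r t :: real and m :: nat
  assumes c: "c > 0"
  defines "F \<equiv> far_phase c m r t"
  shows "(integral {- pi..pi} (E_far c m r t \<phi> \<theta>) \<times> integral {- pi..pi} (B_far c m r t \<phi> \<theta>))
      \<bullet> sph_normal \<phi> \<theta> =
    (real m)\<^sup>2 / (c ^ 3 * (r\<^sup>2 + 1)) * transverse \<phi> \<theta>
      (x_moment m (\<lambda>u. cos (F (sin \<phi> * u))) \<theta>) (y_moment m (\<lambda>u. cos (F (sin \<phi> * u))) \<theta>)
      (x_moment m (\<lambda>u. cos (F (sin \<phi> * u))) \<theta>) (y_moment m (\<lambda>u. cos (F (sin \<phi> * u))) \<theta>)"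
proof -
  define R where "R = sqrt (r\<^sup>2 + 1)"
  have R0: "R > 0" unfolding R_def by (auto intro: add_nonneg_pos)
  have R2: "r\<^sup>2 + 1 = R\<^sup>2" unfolding R_def by simp
  define n where "n = sph_normal \<phi> \<theta>"
  define X Y where "X = x_moment m (\<lambda>u. cos (F (sin \<phi> * u))) \<theta>"
    and "Y = y_moment m (\<lambda>u. cos (F (sin \<phi> * u))) \<theta>"
  define j where "j = real m *\<^sub>R (X *\<^sub>R axis 1 1 + Y *\<^sub>R axis 2 1 :: real ^ 3)"
  define a where "a = integral {- pi..pi} (\<lambda>s. - (real m * cos (real m * s) * sin (F (sin \<phi> * cos (\<theta> - s)))) / (c * R))"
  have X: "((\<lambda>s. - (sin (real m * s) * sin s) * cos (F (sin \<phi> * cos (\<theta> - s)))) has_integral X) {-pi..pi}"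
    unfolding X_def x_moment_def F_def
    by (intro integrable_integral integrable_continuous_interval continuous_intros)
  have Y: "((\<lambda>s. sin (real m * s) * cos s * cos (F (sin \<phi> * cos (\<theta> - s)))) has_integral Y) {-pi..pi}"
    unfolding Y_def y_moment_def F_def
    by (intro integrable_integral integrable_continuous_interval continuous_intros)
  have a: "((\<lambda>s. - (real m * cos (real m * s) * sin (F (sin \<phi> * cos (\<theta> - s)))) / (c * R)) has_integral a) {-pi..pi}"
    unfolding a_def F_def
    by (intro integrable_integral integrable_continuous_interval continuous_intros) (use c R0 in auto)
  have J: "((\<lambda>s. (real m * sin (real m * s) * cos (F (sin \<phi> * cos (\<theta> - s)))) *\<^sub>R circ_tangent s)
      has_integral j) {-pi..pi}"
  proof -
    have "((\<lambda>s. real m *\<^sub>R ((- (sin (real m * s) * sin s) * cos (F (sin \<phi> * cos (\<theta> - s)))) *\<^sub>R axis 1 1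
      + (sin (real m * s) * cos s * cos (F (sin \<phi> * cos (\<theta> - s)))) *\<^sub>R axis 2 1 :: real ^ 3)) has_integral j) {-pi..pi}"
      unfolding j_def by (intro has_integral_cmul has_integral_add has_integral_scaleR_left X Y)
    then show ?thesis
      by (rule has_integral_eq[rotated]) (simp add: circ_tangent_axis algebra_simps)
  qed
  have "((\<lambda>s. (- (real m * cos (real m * s) * sin (F (sin \<phi> * cos (\<theta> - s)))) / (c * R)) *\<^sub>R n
     - (1 / (c\<^sup>2 * R)) *\<^sub>R ((real m * sin (real m * s) * cos (F (sin \<phi> * cos (\<theta> - s)))) *\<^sub>R circ_tangent s))
     has_integral (a *\<^sub>R n - (1 / (c\<^sup>2 * R)) *\<^sub>R j)) {-pi..pi}"
    by (intro has_integral_diff has_integral_scaleR_left has_integral_cmul a J)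
  then have "(E_far c m r t \<phi> \<theta> has_integral (a *\<^sub>R n - (1 / (c\<^sup>2 * R)) *\<^sub>R j)) {-pi..pi}"
    by (rule has_integral_eq[rotated]) (simp add: E_far_def F_def R_def n_def)
  then have E: "integral {-pi..pi} (E_far c m r t \<phi> \<theta>) = a *\<^sub>R n - (1 / (c\<^sup>2 * R)) *\<^sub>R j"
    by (rule integral_unique)
  have lin: "bounded_linear (\<lambda>v. v \<times> n)"
    by (simp add: linear_conv_bounded_linear[symmetric] linearI cross_add_left cross_mult_left)
  have "((\<lambda>s. (1 / (c * R)) *\<^sub>R (((real m * sin (real m * s) * cos (F (sin \<phi> * cos (\<theta> - s)))) *\<^sub>R circ_tangent s) \<times> n))
     has_integral (1 / (c * R)) *\<^sub>R (j \<times> n)) {-pi..pi}"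
    using has_integral_linear[OF J lin] by (intro has_integral_cmul) (simp add: o_def)
  then have "(B_far c m r t \<phi> \<theta> has_integral (1 / (c * R)) *\<^sub>R (j \<times> n)) {-pi..pi}"
    by (rule has_integral_eq[rotated]) (simp add: B_far_def F_def R_def n_def cross_mult_left)
  then have B: "integral {-pi..pi} (B_far c m r t \<phi> \<theta>) = (1 / (c * R)) *\<^sub>R (j \<times> n)"
    by (rule integral_unique)
  have "norm n = 1" by (simp add: n_def)
  from poynting_radial[OF this, of a "1 / (c\<^sup>2 * R)" j "1 / (c * R)"]
  have "(integral {- pi..pi} (E_far c m r t \<phi> \<theta>) \<times> integral {- pi..pi} (B_far c m r t \<phi> \<theta>)) \<bullet> n
     = 1 / (c ^ 3 * R\<^sup>2) * (j \<bullet> j - (j \<bullet> n)\<^sup>2)"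
    unfolding E B by (simp add: power2_eq_square power3_eq_cube mult_ac)
  \<comment> \<open>As \<open>j\<close> has no third component, \<open>j \<bullet> n\<close> is m
    sin \<phi> (X cos \<theta> + Y sin \<theta>), the origin of the factor
    \<open>(sin \<phi>)\<^sup>2\<close> in \<open>transverse\<close>.\<close>
  also have "j \<bullet> j - (j \<bullet> n)\<^sup>2 = (real m)\<^sup>2 * transverse \<phi> \<theta> X Y X Y"
    by (simp add: j_def n_def sph_normal_def transverse_def inner_vec_def sum_3 axis_def
        power2_eq_square algebra_simps)
  finally show ?thesis unfolding X_def Y_def n_def R2 by simp
qed

lemma norm_integral_diff_le:
  fixes f g :: "real \<Rightarrow> real ^ 3"
  assumes "continuous_on {-pi..pi} f" "continuous_on {-pi..pi} g"
    and "\<And>s. norm (f s - g s) \<le> B"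
  shows "norm (integral {-pi..pi} f - integral {-pi..pi} g) \<le> 2 * pi * B"
proof -
  have "integral {-pi..pi} f - integral {-pi..pi} g = integral {-pi..pi} (\<lambda>s. f s - g s)"
    using assms(1,2) by (simp add: integral_diff integrable_continuous_interval)
  also have "norm \<dots> \<le> B * (pi - - pi)"
    by (rule integral_bound_interval) (use assms in \<open>auto intro: continuous_intros\<close>)
  finally show ?thesis by (simp add: algebra_simps)
qed

text \<open>With exact field integrals e, b and far ones e0, b0, the error is (e - e0) x b + e0 x (b
  - b0), each term O(1/R^2) times O(1/R). The constant is uniform in the angles, so the bound
  survives integration.\<close>

lemma flux_density_estimate:
  assumes c: "c > 0"
  shows "\<exists>K\<ge>0. \<forall>r\<ge>2. \<forall>\<phi> \<theta>.
    \<bar>(E_m \<epsilon>0 c m (r *\<^sub>R sph_normal \<phi> \<theta>) t \<times> B_m \<mu>0 c m (r *\<^sub>R sph_normal \<phi> \<theta>) t) \<bullet> sph_normal \<phi> \<theta>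
     - \<mu>0 / (16 * pi\<^sup>2 * \<epsilon>0 * c ^ 3) * (real m)\<^sup>2 / (r\<^sup>2 + 1) * transverse \<phi> \<theta>
      (x_moment m (\<lambda>u. cos (far_phase c m r t (sin \<phi> * u))) \<theta>) (y_moment m (\<lambda>u. cos (far_phase c m r t (sin \<phi> * u))) \<theta>)
      (x_moment m (\<lambda>u. cos (far_phase c m r t (sin \<phi> * u))) \<theta>) (y_moment m (\<lambda>u. cos (far_phase c m r t (sin \<phi> * u))) \<theta>)\<bar>
    \<le> K / sqrt (r\<^sup>2 + 1) ^ 3"
proof -
  define k where "k = 3 * (real m * (real m / c)) + 6 * real m"
  define CE CB DE DB where "CE = 2 * pi * (9 + k / c + 6 * (real m / c) + k / c\<^sup>2)"
    and "CB = 2 * pi * (9 + k / c + 6 * (real m / c))"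
    and "DE = 2 * pi * (real m / c + real m / c\<^sup>2)"
    and "DB = 2 * pi * (real m / c)"
  have pos: "CE \<ge> 0" "CB \<ge> 0" "DE \<ge> 0" "DB \<ge> 0"
    using c by (auto simp: CE_def CB_def DE_def DB_def k_def)
  \<comment> \<open>Product of the prefactors 1/(4 \<open>pi\<close> \<epsilon>0) and \<mu>0/(4
    \<open>pi\<close>) of the two fields.\<close>
  define q where "q = \<mu>0 / (16 * pi\<^sup>2 * \<epsilon>0)"
  define K where "K = \<bar>q\<bar> * (CE * (DB + CB) + DE * CB)"
  show ?thesis
  proof (intro exI[of _ K] conjI allI impI)
    show "0 \<le> K" unfolding K_def using pos by auto
    fix r \<phi> \<theta> :: real
    assume r: "r \<ge> 2"
    define R where "R = sqrt (r\<^sup>2 + 1)"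
    have R1: "R \<ge> 1" unfolding R_def by simp
    define n where "n = sph_normal \<phi> \<theta>"
    define e e0 b b0 where "e = integral {-pi..pi} (E_integrand c m (r *\<^sub>R n) t)"
      and "e0 = integral {-pi..pi} (E_far c m r t \<phi> \<theta>)"
      and "b = integral {-pi..pi} (B_integrand c m (r *\<^sub>R n) t)"
      and "b0 = integral {-pi..pi} (B_far c m r t \<phi> \<theta>)"
    note est = integrand_estimates[OF c r, where m = m and \<phi> = \<phi> and \<theta> = \<theta> and t = t, folded k_def R_def n_def]
    have nr: "1 < norm (r *\<^sub>R n)" using r by (simp add: n_def)
    have ceb: "continuous_on {-pi..pi} (E_integrand c m (r *\<^sub>R n) t)"
      "continuous_on {-pi..pi} (B_integrand c m (r *\<^sub>R n) t)"
    proof -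
      have *: "continuous_on {-pi..pi} (\<lambda>s. (r *\<^sub>R n, s))" by (intro continuous_intros)
      have **: "(\<lambda>s. (r *\<^sub>R n, s)) ` {-pi..pi} \<subseteq> Sigma {x. 1 < norm x} (\<lambda>_. UNIV)"
        using nr by auto
      show "continuous_on {-pi..pi} (E_integrand c m (r *\<^sub>R n) t)"
        using continuous_on_compose2[OF continuous_on_integrands(1)[OF c, of m t] * **] by simp
      show "continuous_on {-pi..pi} (B_integrand c m (r *\<^sub>R n) t)"
        using continuous_on_compose2[OF continuous_on_integrands(2)[OF c, of m t] * **] by simp
    qed
    have ceb0: "continuous_on {-pi..pi} (E_far c m r t \<phi> \<theta>)"
      "continuous_on {-pi..pi} (B_far c m r t \<phi> \<theta>)"
    proof -
      have nz: "\<forall>s\<in>{-pi..pi}. c * sqrt (r\<^sup>2 + 1) \<noteq> 0" "\<forall>s\<in>{-pi..pi}. c\<^sup>2 * sqrt (r\<^sup>2 + 1) \<noteq> 0"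
        using c R1 unfolding R_def[symmetric] by auto
      show "continuous_on {-pi..pi} (E_far c m r t \<phi> \<theta>)"
        unfolding E_far_def by (intro continuous_intros nz)
      show "continuous_on {-pi..pi} (B_far c m r t \<phi> \<theta>)"
        unfolding B_far_def by (intro continuous_intros continuous_on_cross nz)
    qed
    have "norm (e - e0) \<le> 2 * pi * ((9 + k / c + 6 * (real m / c) + k / c\<^sup>2) / R\<^sup>2)"
      unfolding e_def e0_def by (rule norm_integral_diff_le[OF ceb(1) ceb0(1) est(1)])
    then have de: "norm (e - e0) \<le> CE / R\<^sup>2" by (simp only: CE_def times_divide_eq_right)
    have "norm (b - b0) \<le> 2 * pi * ((9 + k / c + 6 * (real m / c)) / R\<^sup>2)"
      unfolding b_def b0_def by (rule norm_integral_diff_le[OF ceb(2) ceb0(2) est(2)])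
    then have db: "norm (b - b0) \<le> CB / R\<^sup>2" by (simp only: CB_def times_divide_eq_right)
    have "norm (e0 - 0) \<le> 2 * pi * ((real m / c + real m / c\<^sup>2) / R)"
      using norm_integral_diff_le[OF ceb0(1) continuous_on_const[of _ 0], unfolded integral_0 diff_zero, OF est(3)]
      by (simp only: e0_def diff_zero)
    then have ne0: "norm e0 \<le> DE / R" by (simp add: DE_def)
    have "norm (b0 - 0) \<le> 2 * pi * ((real m / c) / R)"
      using norm_integral_diff_le[OF ceb0(2) continuous_on_const[of _ 0], unfolded integral_0 diff_zero, OF est(4)]
      by (simp only: b0_def diff_zero)
    then have nb0: "norm b0 \<le> DB / R" by (simp add: DB_def)
    have "CB / R\<^sup>2 \<le> CB / R"
      using R1 pos by (intro divide_left_mono) (auto simp: power2_eq_square)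
    then have nb: "norm b \<le> (DB + CB) / R"
      using norm_triangle_ineq[of b0 "b - b0"] nb0 db by (simp add: add_divide_distrib)
    have "e \<times> b - e0 \<times> b0 = (e - e0) \<times> b + e0 \<times> (b - b0)"
      by (simp add: Cross3.left_diff_distrib Cross3.right_diff_distrib)
    also have "norm \<dots> \<le> norm (e - e0) * norm b + norm e0 * norm (b - b0)"
      by (intro order_trans[OF norm_triangle_ineq] add_mono norm_cross_le)
    also have "\<dots> \<le> CE / R\<^sup>2 * ((DB + CB) / R) + DE / R * (CB / R\<^sup>2)"
      by (intro add_mono mult_mono de db ne0 nb) (use pos R1 in auto)
    also have "\<dots> = (CE * (DB + CB) + DE * CB) / R ^ 3"
      using R1 by (simp add: power2_eq_square power3_eq_cube field_simps)
    finally have cr: "norm (e \<times> b - e0 \<times> b0) \<le> (CE * (DB + CB) + DE * CB) / R ^ 3" .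
    have "\<bar>(e \<times> b) \<bullet> n - (e0 \<times> b0) \<bullet> n\<bar> \<le> norm (e \<times> b - e0 \<times> b0)"
      using Cauchy_Schwarz_ineq2[of "e \<times> b - e0 \<times> b0" n] by (simp add: inner_diff_left n_def)
    then have dot: "\<bar>q\<bar> * \<bar>(e \<times> b) \<bullet> n - (e0 \<times> b0) \<bullet> n\<bar> \<le> \<bar>q\<bar> * ((CE * (DB + CB) + DE * CB) / R ^ 3)"
      using cr by (intro mult_left_mono) auto
    have EB: "(E_m \<epsilon>0 c m (r *\<^sub>R n) t \<times> B_m \<mu>0 c m (r *\<^sub>R n) t) \<bullet> n = q * ((e \<times> b) \<bullet> n)"
      unfolding E_m_integrand B_m_integrand e_def[symmetric] b_def[symmetric]
      by (simp add: cross_mult_left cross_mult_right q_def power2_eq_square)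
    have ff: "\<mu>0 / (16 * pi\<^sup>2 * \<epsilon>0 * c ^ 3) * (real m)\<^sup>2 / (r\<^sup>2 + 1) * T
      = q * ((real m)\<^sup>2 / (c ^ 3 * (r\<^sup>2 + 1)) * T)" for T
      by (simp add: q_def)
    show "\<bar>(E_m \<epsilon>0 c m (r *\<^sub>R sph_normal \<phi> \<theta>) t \<times> B_m \<mu>0 c m (r *\<^sub>R sph_normal \<phi> \<theta>) t) \<bullet> sph_normal \<phi> \<theta>
     - \<mu>0 / (16 * pi\<^sup>2 * \<epsilon>0 * c ^ 3) * (real m)\<^sup>2 / (r\<^sup>2 + 1) * transverse \<phi> \<theta>
      (x_moment m (\<lambda>u. cos (far_phase c m r t (sin \<phi> * u))) \<theta>) (y_moment m (\<lambda>u. cos (far_phase c m r t (sin \<phi> * u))) \<theta>)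
      (x_moment m (\<lambda>u. cos (far_phase c m r t (sin \<phi> * u))) \<theta>) (y_moment m (\<lambda>u. cos (far_phase c m r t (sin \<phi> * u))) \<theta>)\<bar>
    \<le> K / sqrt (r\<^sup>2 + 1) ^ 3"
      unfolding ff far_flux_density[OF c, symmetric] n_def[symmetric] EB R_def[symmetric]
        e0_def[symmetric] b0_def[symmetric] right_diff_distrib[symmetric] abs_mult
      using dot by (simp add: K_def)
  qed
qed

section \<open>The flux\<close>

lemma integral_antiperiodic:
  fixes g :: "real \<Rightarrow> real"
  assumes "continuous_on UNIV g" "\<And>s. g (s + pi) = - g s"
  shows "integral {-pi..pi} g = 0"
proof -
  have "integral {-pi..0} g + integral {0..pi} g = integral {-pi..pi} g"
    by (intro Henstock_Kurzweil_Integration.integral_combine integrable_continuous_interval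
        continuous_on_subset[OF assms(1)]) auto
  moreover have "integral {0..pi} g = integral {-pi..0} (\<lambda>s. g (s + pi))"
    using integral_shift_real_ivl[of 0 pi pi g] by simp
  ultimately show ?thesis by (simp add: assms(2))
qed

text \<open>Under a shift of the source angle by \<open>pi\<close> the tangent changes sign,
  \<open>sin (real m * s)\<close> gains (-1)^m and \<open>f\<close> sees its argument negated; the
  hypothesis on \<open>f\<close> makes the total sign negative.\<close>

lemma moment_parity:
  assumes f: "continuous_on UNIV f" and par: "\<And>u. f (- u) = (if even m then f u else - f u)"
  shows "x_moment m f \<theta> = 0" "y_moment m f \<theta> = 0"
proof -
  note [continuous_intros] = continuous_on_compose2[OF f]
  have m: "sin (real m * (s + pi)) = (if even m then sin (real m * s) else - sin (real m * s))" for s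
    by (simp add: distrib_left sin_add cos_npi sin_npi)
  have c: "cos (\<theta> - (s + pi)) = - cos (\<theta> - s)" for s
    by (simp add: cos_diff)
  show "x_moment m f \<theta> = 0"
    unfolding x_moment_def
    by (rule integral_antiperiodic) (auto intro!: continuous_intros simp: m c par)
  show "y_moment m f \<theta> = 0"
    unfolding y_moment_def
    by (rule integral_antiperiodic) (auto intro!: continuous_intros simp: m c par)
qed

lemma moment_diff:
  assumes "continuous_on UNIV f" "continuous_on UNIV g"
  shows "x_moment m (\<lambda>u. f u - g u) \<theta> = x_moment m f \<theta> - x_moment m g \<theta>"
    and "y_moment m (\<lambda>u. f u - g u) \<theta> = y_moment m f \<theta> - y_moment m g \<theta>"
proof -
  note [continuous_intros] = continuous_on_compose2[OF assms(1)] continuous_on_compose2[OF assms(2)]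
  show "x_moment m (\<lambda>u. f u - g u) \<theta> = x_moment m f \<theta> - x_moment m g \<theta>"
    unfolding x_moment_def right_diff_distrib
    by (intro integral_diff integrable_continuous_interval continuous_intros) auto
  show "y_moment m (\<lambda>u. f u - g u) \<theta> = y_moment m f \<theta> - y_moment m g \<theta>"
    unfolding y_moment_def right_diff_distrib
    by (intro integral_diff integrable_continuous_interval continuous_intros) auto
qed

text \<open>After the addition theorem for cos (A + \<kappa> u), parity kills one of the two moments
  entirely, so the quadratic form has no mixed term and the time dependence factors out as a
  square.\<close>

lemma flux_form_phase:
  assumes "\<And>u. F u = A + \<kappa> * u"
  shows "flux_form m (\<lambda>u. cos (F u)) (\<lambda>u. cos (F u)) \<phi> \<theta> =
    (if even m then (sin A)\<^sup>2 * flux_form m (\<lambda>u. sin (\<kappa> * u)) (\<lambda>u. sin (\<kappa> * u)) \<phi> \<theta>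
     else (cos A)\<^sup>2 * flux_form m (\<lambda>u. cos (\<kappa> * u)) (\<lambda>u. cos (\<kappa> * u)) \<phi> \<theta>)"
proof -
  let ?S = "\<lambda>u. sin (\<kappa> * (sin \<phi> * u))" and ?C = "\<lambda>u. cos (\<kappa> * (sin \<phi> * u))"
  have eq: "(\<lambda>u. cos (F (sin \<phi> * u))) = (\<lambda>u. cos A * ?C u - sin A * ?S u)"
    by (simp add: assms cos_add)
  have c: "continuous_on UNIV (\<lambda>u. cos A * ?C u)" "continuous_on UNIV (\<lambda>u. sin A * ?S u)"
    "continuous_on UNIV ?C" "continuous_on UNIV ?S"
    by (intro continuous_intros)+
  have XY: "x_moment m (\<lambda>u. cos (F (sin \<phi> * u))) \<theta> = cos A * x_moment m ?C \<theta> - sin A * x_moment m ?S \<theta>"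
    "y_moment m (\<lambda>u. cos (F (sin \<phi> * u))) \<theta> = cos A * y_moment m ?C \<theta> - sin A * y_moment m ?S \<theta>"
    unfolding eq moment_diff[OF c(1,2)] by (simp_all only: moment_cmult)
  show ?thesis
    unfolding flux_form_def XY
    using moment_parity[OF c(3), of m \<theta>] moment_parity[OF c(4), of m \<theta>]
    by (auto simp: transverse_def power2_eq_square algebra_simps)
qed

section \<open>Integration over the sphere\<close>

lemma iint_diff_bound:
  assumes "continuous_on UNIV (\<lambda>z. f (fst z) (snd z))" "continuous_on UNIV (\<lambda>z. g (fst z) (snd z))"
    and "\<And>\<phi> \<theta>. \<bar>f \<phi> \<theta> - g \<phi> \<theta>\<bar> \<le> B"
  shows "\<bar>iint f - iint g\<bar> \<le> 2 * pi\<^sup>2 * B"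
proof -
  have "iint f - iint g = iint (\<lambda>\<phi> \<theta>. f \<phi> \<theta> - g \<phi> \<theta>)"
    using continuous_on_subset[OF assms(1)] continuous_on_subset[OF assms(2)]
    by (simp add: iint_2dim assms(1,2) continuous_on_diff integral_diff integrable_continuous)
  then show ?thesis
    using iint_abs_le[of "\<lambda>\<phi> \<theta>. f \<phi> \<theta> - g \<phi> \<theta>" B] assms by (simp add: continuous_on_diff)
qed

lemma iint_cmult: "iint (\<lambda>\<phi> \<theta>. k * f \<phi> \<theta>) = k * iint f"
  unfolding iint_def by (simp only: integral_mult_right)

lemma P_flux_estimate:
  assumes c: "c > 0"
  shows "\<exists>K. \<forall>r\<ge>2. \<bar>P_flux \<epsilon>0 \<mu>0 c m r t
     - \<mu>0 / (16 * pi\<^sup>2 * \<epsilon>0 * c ^ 3) * (real m)\<^sup>2 / (r\<^sup>2 + 1) * r\<^sup>2 *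
       iint (flux_form m (\<lambda>u. cos (far_phase c m r t u)) (\<lambda>u. cos (far_phase c m r t u)))\<bar> \<le> K / r"
proof -
  obtain K where K: "K \<ge> 0" and est: "\<And>r \<phi> \<theta>. r \<ge> 2 \<Longrightarrow>
    \<bar>(E_m \<epsilon>0 c m (r *\<^sub>R sph_normal \<phi> \<theta>) t \<times> B_m \<mu>0 c m (r *\<^sub>R sph_normal \<phi> \<theta>) t) \<bullet> sph_normal \<phi> \<theta>
     - \<mu>0 / (16 * pi\<^sup>2 * \<epsilon>0 * c ^ 3) * (real m)\<^sup>2 / (r\<^sup>2 + 1) * transverse \<phi> \<theta>
      (x_moment m (\<lambda>u. cos (far_phase c m r t (sin \<phi> * u))) \<theta>) (y_moment m (\<lambda>u. cos (far_phase c m r t (sin \<phi> * u))) \<theta>)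
      (x_moment m (\<lambda>u. cos (far_phase c m r t (sin \<phi> * u))) \<theta>) (y_moment m (\<lambda>u. cos (far_phase c m r t (sin \<phi> * u))) \<theta>)\<bar>
    \<le> K / sqrt (r\<^sup>2 + 1) ^ 3"
    using flux_density_estimate[OF c, of \<epsilon>0 m t \<mu>0] by blast
  show ?thesis
  proof (intro exI[of _ "2 * pi\<^sup>2 * K"] allI impI)
    fix r :: real assume r: "r \<ge> 2"
    define k where "k = \<mu>0 / (16 * pi\<^sup>2 * \<epsilon>0 * c ^ 3) * (real m)\<^sup>2 / (r\<^sup>2 + 1)"
    define C where "C = (\<lambda>u. cos (far_phase c m r t u))"
    define f where "f = (\<lambda>\<phi> \<theta>. ((E_m \<epsilon>0 c m (r *\<^sub>R sph_normal \<phi> \<theta>) t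
      \<times> B_m \<mu>0 c m (r *\<^sub>R sph_normal \<phi> \<theta>) t) \<bullet> sph_normal \<phi> \<theta>) * (r\<^sup>2 * sin \<phi>))"
    have C: "continuous_on UNIV C" unfolding C_def by (intro continuous_intros)
    have n: "continuous_on UNIV (\<lambda>z. r *\<^sub>R sph_normal (fst z) (snd z))" by (intro continuous_intros)
    have "(\<lambda>z. r *\<^sub>R sph_normal (fst z) (snd z)) ` UNIV \<subseteq> {x. 1 < norm x}"
      using r by auto
    note EB = continuous_on_compose2[OF continuous_on_fields(1)[OF c] n this]
      continuous_on_compose2[OF continuous_on_fields(2)[OF c] n this]
    have cf: "continuous_on UNIV (\<lambda>z. f (fst z) (snd z))"
      unfolding f_def by (intro continuous_intros continuous_on_cross EB)
    have cg: "continuous_on UNIV (\<lambda>z. (k * r\<^sup>2) * flux_form m C C (fst z) (snd z))"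
      by (intro continuous_on_mult_left continuous_on_flux_form C)
    have rR: "r \<le> sqrt (r\<^sup>2 + 1)" using r by (intro real_le_rsqrt) simp
    have R0: "0 < sqrt (r\<^sup>2 + 1)" using r rR by linarith
    have R2: "sqrt (r\<^sup>2 + 1) ^ 3 = sqrt (r\<^sup>2 + 1) * (r\<^sup>2 + 1)" by (simp add: power3_eq_cube)
    have bound: "\<bar>f \<phi> \<theta> - (k * r\<^sup>2) * flux_form m C C \<phi> \<theta>\<bar> \<le> K / r" for \<phi> \<theta>
    proof -
      let ?D = "(E_m \<epsilon>0 c m (r *\<^sub>R sph_normal \<phi> \<theta>) t \<times> B_m \<mu>0 c m (r *\<^sub>R sph_normal \<phi> \<theta>) t) \<bullet> sph_normal \<phi> \<theta>
          - k * transverse \<phi> \<theta>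
      (x_moment m (\<lambda>u. C (sin \<phi> * u)) \<theta>) (y_moment m (\<lambda>u. C (sin \<phi> * u)) \<theta>)
      (x_moment m (\<lambda>u. C (sin \<phi> * u)) \<theta>) (y_moment m (\<lambda>u. C (sin \<phi> * u)) \<theta>)"
      have *: "a * (r\<^sup>2 * sin \<phi>) - k * r\<^sup>2 * (sin \<phi> * b) = r\<^sup>2 * (sin \<phi> * (a - k * b))" for a b
        by (simp add: algebra_simps)
      have "f \<phi> \<theta> - (k * r\<^sup>2) * flux_form m C C \<phi> \<theta> = r\<^sup>2 * (sin \<phi> * ?D)"
        unfolding f_def flux_form_def by (rule *)
      then have "\<bar>f \<phi> \<theta> - (k * r\<^sup>2) * flux_form m C C \<phi> \<theta>\<bar> = r\<^sup>2 * (\<bar>sin \<phi>\<bar> * \<bar>?D\<bar>)"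
        by (simp only: abs_mult abs_power2)
      also have "\<dots> \<le> r\<^sup>2 * (1 * (K / sqrt (r\<^sup>2 + 1) ^ 3))"
        using est[OF r, of \<phi> \<theta>]
        by (intro mult_left_mono mult_mono) (auto simp: k_def C_def)
      also have "\<dots> = K * (r\<^sup>2 / (r\<^sup>2 + 1)) * (1 / sqrt (r\<^sup>2 + 1))"
        unfolding R2 by (simp add: mult_ac)
      also have "\<dots> \<le> K * 1 * (1 / r)"
        by (intro mult_mono divide_left_mono)
          (use K r rR R0 in \<open>auto simp: divide_le_eq_1 intro: add_nonneg_pos mult_pos_pos\<close>)
      finally show ?thesis by simp
    qed
    have "P_flux \<epsilon>0 \<mu>0 c m r t = iint f"
      by (simp add: P_flux_def sphere_flux_def iint_def f_def)
    then show "\<bar>P_flux \<epsilon>0 \<mu>0 c m r t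
     - \<mu>0 / (16 * pi\<^sup>2 * \<epsilon>0 * c ^ 3) * (real m)\<^sup>2 / (r\<^sup>2 + 1) * r\<^sup>2 *
       iint (flux_form m (\<lambda>u. cos (far_phase c m r t u)) (\<lambda>u. cos (far_phase c m r t u)))\<bar> \<le> 2 * pi\<^sup>2 * K / r"
      using iint_diff_bound[OF cf cg bound]
      unfolding k_def[symmetric] C_def[symmetric] iint_cmult by simp
  qed
qed

text \<open>Common argument for both parities: \<open>h\<close> is the surviving sine or cosine,
  \<open>S r\<close> the squared time factor and \<open>T r\<close> the value of the double
  series.\<close>

lemma flux_asymptotics:
  assumes c: "c > 0" and eps: "\<epsilon>0 > 0" and mu: "\<mu>0 > 0"
    and h: "continuous_on UNIV h" "\<And>u. \<bar>h u\<bar> \<le> 1"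
    and S: "\<And>r. \<bar>S r\<bar> \<le> 1"
    and form: "\<And>r \<phi> \<theta>. r > 0 \<Longrightarrow>
        flux_form m (\<lambda>u. cos (far_phase c m r t u)) (\<lambda>u. cos (far_phase c m r t u)) \<phi> \<theta>
        = S r * flux_form m (\<lambda>u. h (\<kappa> r * u)) (\<lambda>u. h (\<kappa> r * u)) \<phi> \<theta>"
    and T: "\<And>r. r > 0 \<Longrightarrow> T r = - (r ^ 3 * iint (flux_form m (\<lambda>u. h (\<kappa> r * u)) (\<lambda>u. h (\<kappa> r * u))))"
  shows "(\<lambda>r. P_flux \<epsilon>0 \<mu>0 c m r t
         - beta_coeff \<mu>0 c r * gamma_coeff \<epsilon>0 c r * (real m)\<^sup>2 * (- S r) * T r) \<in> O[at_top](\<lambda>r. 1 / r)"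
proof -
  obtain K where K: "\<And>r. r \<ge> 2 \<Longrightarrow> \<bar>P_flux \<epsilon>0 \<mu>0 c m r t
     - \<mu>0 / (16 * pi\<^sup>2 * \<epsilon>0 * c ^ 3) * (real m)\<^sup>2 / (r\<^sup>2 + 1) * r\<^sup>2 *
       iint (flux_form m (\<lambda>u. cos (far_phase c m r t u)) (\<lambda>u. cos (far_phase c m r t u)))\<bar> \<le> K / r"
    using P_flux_estimate[OF c, of \<epsilon>0 \<mu>0 m t] by blast
  define Q where "Q = \<mu>0 / (16 * pi\<^sup>2 * \<epsilon>0 * c ^ 3) * (real m)\<^sup>2"
  have Q: "Q \<ge> 0" using c eps mu by (simp add: Q_def)
  \<comment> \<open>Area of the rectangle times the bound from \<open>flux_form_bound\<close> for
    functions bounded by 1.\<close>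
  define D where "D = 2 * pi\<^sup>2 * (24 * pi\<^sup>2 * (1 * 1))"
  have D: "D \<ge> 0" by (simp add: D_def)
  have "\<bar>P_flux \<epsilon>0 \<mu>0 c m r t
     - beta_coeff \<mu>0 c r * gamma_coeff \<epsilon>0 c r * (real m)\<^sup>2 * (- S r) * T r\<bar> \<le> (K + Q * D) / r"
    if r: "r \<ge> 2" for r
  proof -
    define R where "R = sqrt (r\<^sup>2 + 1)"
    have R2: "r\<^sup>2 + 1 = R\<^sup>2" unfolding R_def by simp
    have rR: "r \<le> R" unfolding R_def using r by (intro real_le_rsqrt) simp
    have Rr: "R \<le> r + 1" unfolding R_def using r
      by (intro real_le_lsqrt) (auto simp: power2_eq_square algebra_simps)
    define Z where "Z = iint (flux_form m (\<lambda>u. h (\<kappa> r * u)) (\<lambda>u. h (\<kappa> r * u)))"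
    have hc: "continuous_on UNIV (\<lambda>u. h (\<kappa> r * u))"
      by (rule continuous_on_compose2[OF h(1)]) (auto intro: continuous_intros)
    have Z: "\<bar>Z\<bar> \<le> D"
      unfolding Z_def D_def
      by (intro iint_abs_le continuous_on_flux_form flux_form_bound hc h)
    have r0: "r > 0" using r by simp
    have fl: "flux_form m (\<lambda>u. cos (far_phase c m r t u)) (\<lambda>u. cos (far_phase c m r t u))
        = (\<lambda>\<phi> \<theta>. S r * flux_form m (\<lambda>u. h (\<kappa> r * u)) (\<lambda>u. h (\<kappa> r * u)) \<phi> \<theta>)"
      by (intro ext form r0)
    have 1: "\<bar>P_flux \<epsilon>0 \<mu>0 c m r t - Q / R\<^sup>2 * r\<^sup>2 * (S r * Z)\<bar> \<le> K / r"
      using K[OF r] unfolding fl iint_cmult Z_def[symmetric] Q_def[symmetric] R2 .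
    have R0: "R > 0" using rR r by linarith
    have bg: "beta_coeff \<mu>0 c r * gamma_coeff \<epsilon>0 c r * (real m)\<^sup>2 = Q / R ^ 3"
      unfolding beta_coeff_def gamma_coeff_def Q_def R_def[symmetric] R2
      using R0 by (simp add: power2_eq_square power3_eq_cube mult_ac)
    \<comment> \<open>The signs of \<open>- S r\<close> and \<open>T r\<close> cancel. The
      difference between r^2/R^2 and r^3/R^3 is (R - r) r^2/R^3, at most 1/r.\<close>
    have "Q / R\<^sup>2 * r\<^sup>2 * (S r * Z)
       - beta_coeff \<mu>0 c r * gamma_coeff \<epsilon>0 c r * (real m)\<^sup>2 * (- S r) * T r
       = Q * (S r * Z) * ((R - r) * (r\<^sup>2 / R\<^sup>2 * (1 / R)))"
      unfolding bg T[OF r0] Z_def[symmetric]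
      using r0 rR by (simp add: field_simps power2_eq_square power3_eq_cube)
    also have "\<bar>\<dots>\<bar> \<le> (Q * (1 * D)) * (1 * (1 * (1 / r)))"
      unfolding abs_mult[of "Q * _"] abs_mult[of Q] abs_mult[of "S r"]
        abs_mult[of "R - r"] abs_mult[of "_ / _" "_ / _"]
      by (intro mult_mono S Z) (use Q D rR Rr r0 in \<open>auto intro!: divide_left_mono power_mono mult_pos_pos\<close>)
    finally have "\<bar>Q / R\<^sup>2 * r\<^sup>2 * (S r * Z)
       - beta_coeff \<mu>0 c r * gamma_coeff \<epsilon>0 c r * (real m)\<^sup>2 * (- S r) * T r\<bar>
      \<le> Q * (1 * D) * (1 * (1 * (1 / r)))" .
    moreover have "Q * (1 * D) * (1 * (1 * (1 / r))) = Q * D / r" by simp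
    moreover have "\<bar>a - b\<bar> \<le> x + y" if "\<bar>a - q\<bar> \<le> x" "\<bar>q - b\<bar> \<le> y" for a b q x y :: real
      using that by linarith
    ultimately show ?thesis using 1 unfolding add_divide_distrib by metis
  qed
  then show ?thesis
    by (intro bigoI[of _ "K + Q * D"] eventually_at_top_linorderI[of 2]) auto
qed

section \<open>The double series in closed form\<close>

lemma powr_nat_plus_half:
  assumes "0 < x"
  shows "x powr (real w + 1 / 2) = sqrt x ^ (2 * w + 1)"
proof -
  have "sqrt x ^ (2 * w) = x ^ w" using assms by (simp add: power_mult)
  then show ?thesis using assms by (simp add: powr_add powr_realpow powr_half_sqrt)
qed

text \<open>A subseries of the exponential series with nonnegative terms; it is the majorant for the
  sine and cosine series on [-1, 1].\<close>

lemma summable_power_fact_reindex: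
  fixes K :: real
  assumes "strict_mono g"
  shows "summable (\<lambda>n. \<bar>K\<bar> ^ g n / fact (g n))"
proof -
  have "summable ((\<lambda>n. inverse (fact n) * \<bar>K\<bar> ^ n) \<circ> g)"
    by (rule summable_reindex[OF summable_exp])
      (use assms strict_mono_imp_inj_on in auto)
  then show ?thesis by (simp add: o_def field_simps)
qed

lemma iterated_flux_series:
  fixes p :: "nat \<Rightarrow> nat" and k K r :: real
  assumes p: "strict_mono p"
    and h: "\<And>x. (\<lambda>n. (-1) ^ n / fact (p n) * x ^ p n) sums h x" "continuous_on UNIV h" "\<And>x. \<bar>h x\<bar> \<le> 1"
    and T: "\<And>w w'. T w w' = - (r ^ 3 * iint (flux_form m
       (\<lambda>u. ((-1) ^ w / fact (p w) * K ^ p w) * u ^ p w) (\<lambda>u. ((-1) ^ w' / fact (p w') * K ^ p w') * u ^ p w')))"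
  shows "iter_summable T"
    and "(\<Sum>w. \<Sum>w'. T w w') = - (r ^ 3 * iint (flux_form m (\<lambda>u. h (K * u)) (\<lambda>u. h (K * u))))"
proof -
  define f where "f = (\<lambda>n u. ((-1) ^ n / fact (p n) * K ^ p n) * u ^ p n)"
  define g where "g = (\<lambda>u. h (K * u))"
  have f1: "continuous_on UNIV (f n)" for n unfolding f_def by (intro continuous_intros)
  have f2: "\<bar>f n u\<bar> \<le> \<bar>K\<bar> ^ p n / fact (p n)" if "\<bar>u\<bar> \<le> 1" for n u
  proof -
    have "(\<bar>K\<bar> ^ p n / fact (p n)) * \<bar>u\<bar> ^ p n \<le> (\<bar>K\<bar> ^ p n / fact (p n)) * 1"
      using that by (intro mult_left_mono power_le_one) auto
    then show ?thesis by (simp add: f_def abs_mult power_abs)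
  qed
  have fg: "(\<lambda>n. f n u) sums g u" for u
    using h(1)[of "K * u"] by (simp add: f_def g_def power_mult_distrib mult.assoc)
  have g: "continuous_on UNIV g" "\<bar>g u\<bar> \<le> 1" for u
    unfolding g_def by (auto intro!: continuous_on_compose2[OF h(2)] continuous_intros h(3))
  note it = flux_form_iterated_sums[where f = f and g = g and B = 1 and m = m,
      OF f1 f2 summable_power_fact_reindex[OF p] fg g(1) g(2)]
  have T': "T w w' = - (r ^ 3) * iint (flux_form m (f w) (f w'))" for w w'
    unfolding T f_def by simp
  have inner: "T w sums (- (r ^ 3) * iint (flux_form m (f w) g))" for w
    unfolding T' by (intro sums_mult it(1))
  have "(\<lambda>w. - (r ^ 3) * iint (flux_form m (f w) g)) sums (- (r ^ 3) * iint (flux_form m g g))"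
    by (intro sums_mult it(2))
  then have outer: "(\<lambda>w. \<Sum>w'. T w w') sums (- (r ^ 3) * iint (flux_form m g g))"
    unfolding sums_unique[OF inner, symmetric] .
  show "iter_summable T"
    unfolding iter_summable_def using inner outer by (auto simp: sums_iff)
  show "(\<Sum>w. \<Sum>w'. T w w') = - (r ^ 3 * iint (flux_form m (\<lambda>u. h (K * u)) (\<lambda>u. h (K * u))))"
    using sums_unique[OF outer] by (simp add: g_def)
qed

text \<open>The coefficient of \<open>u\<close> in \<open>far_phase\<close>. Its powers supply the
  factors (m/c)^p r^p / R^p of the series terms.\<close>

definition wave_number :: "real \<Rightarrow> nat \<Rightarrow> real \<Rightarrow> real" where
  "wave_number c m r = real m / c * (r / sqrt (r\<^sup>2 + 1))"

text \<open>Of the exponent \<open>2*w+2*w'+5\<close>, the two wave number powers absorb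
  \<open>2*w+1\<close> and \<open>2*w'+1\<close>; the remaining r^3 faces the R^3 in the denominator
  of \<open>beta_coeff\<close> times \<open>gamma_coeff\<close>.\<close>

lemma even_term_flux_form:
  "even_term c m r w w' = - (r ^ 3 * iint (flux_form m
     (\<lambda>u. ((-1) ^ w / fact (2*w+1) * wave_number c m r ^ (2*w+1)) * u ^ (2*w+1))
     (\<lambda>u. ((-1) ^ w' / fact (2*w'+1) * wave_number c m r ^ (2*w'+1)) * u ^ (2*w'+1))))"
proof -
  have pos: "0 < r\<^sup>2 + 1" by (simp add: add_nonneg_pos)
  have "2*w+2*w'+5 = 3 + ((2*w+1) + (2*w'+1))" by simp
  then have "r ^ (2*w+2*w'+5) = r ^ 3 * (r ^ (2*w+1) * r ^ (2*w'+1))"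
    by (simp only: power_add)
  then show ?thesis
    unfolding iint_flux_form_power even_term_def c_coeff_eq powr_nat_plus_half[OF pos]
      wave_number_def power_mult_distrib power_divide mult_minus_right minus_minus sum_distrib_left
    by (intro sum.cong refl) (simp add: mult_ac)
qed

lemma odd_term_flux_form:
  "odd_term c m r w w' = - (r ^ 3 * iint (flux_form m
     (\<lambda>u. ((-1) ^ w / fact (2*w) * wave_number c m r ^ (2*w)) * u ^ (2*w))
     (\<lambda>u. ((-1) ^ w' / fact (2*w') * wave_number c m r ^ (2*w')) * u ^ (2*w'))))"
proof -
  have R: "(r\<^sup>2 + 1) ^ n = sqrt (r\<^sup>2 + 1) ^ (2 * n)" for n
    by (simp add: power_mult)
  have "2*w+2*w'+3 = 3 + (2*w + 2*w')" by simp
  then have "r ^ (2*w+2*w'+3) = r ^ 3 * (r ^ (2*w) * r ^ (2*w'))"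
    by (simp only: power_add)
  then show ?thesis
    unfolding iint_flux_form_power odd_term_def d_coeff_eq R
      wave_number_def power_mult_distrib power_divide mult_minus_right minus_minus sum_distrib_left
    by (intro sum.cong refl) (simp add: mult_ac)
qed

lemma far_phase_wave_number:
  "far_phase c m r t u = real m * (t - sqrt (r\<^sup>2 + 1) / c) + wave_number c m r * u"
  by (simp add: far_phase_def wave_number_def)

theorem lemma4p4:
  fixes \<epsilon>0 \<mu>0 c t :: real and m :: nat
  assumes "\<epsilon>0 > 0" and "\<mu>0 > 0" and "c > 0" and "c\<^sup>2 = 1 / (\<epsilon>0 * \<mu>0)"
    and "m \<ge> 1"
  shows "(even m \<longrightarrow>
      (\<forall>r>0. iter_summable (even_term c m r)) \<and>
      (\<lambda>r. P_flux \<epsilon>0 \<mu>0 c m r t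
         - beta_coeff \<mu>0 c r * gamma_coeff \<epsilon>0 c r * (real m)\<^sup>2
           * (- (sin (real m * t))\<^sup>2 * (cos (real m * sqrt (r\<^sup>2 + 1) / c))\<^sup>2
              - (cos (real m * t))\<^sup>2 * (sin (real m * sqrt (r\<^sup>2 + 1) / c))\<^sup>2
              + 2 * sin (real m * t) * cos (real m * t)
                  * sin (real m * sqrt (r\<^sup>2 + 1) / c) * cos (real m * sqrt (r\<^sup>2 + 1) / c))
           * (\<Sum>w. \<Sum>w'. even_term c m r w w')) \<in> O[at_top](\<lambda>r. 1 / r)) \<and>
    (odd m \<longrightarrow>
      (\<forall>r>0. iter_summable (odd_term c m r)) \<and>
      (\<lambda>r. P_flux \<epsilon>0 \<mu>0 c m r t
         - beta_coeff \<mu>0 c r * gamma_coeff \<epsilon>0 c r * (real m)\<^sup>2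
           * (- (cos (real m * t))\<^sup>2 * (cos (real m * sqrt (r\<^sup>2 + 1) / c))\<^sup>2
              - (sin (real m * t))\<^sup>2 * (sin (real m * sqrt (r\<^sup>2 + 1) / c))\<^sup>2
              - 2 * sin (real m * t) * cos (real m * t)
                  * sin (real m * sqrt (r\<^sup>2 + 1) / c) * cos (real m * sqrt (r\<^sup>2 + 1) / c))
           * (\<Sum>w. \<Sum>w'. odd_term c m r w w')) \<in> O[at_top](\<lambda>r. 1 / r))"
proof (intro conjI impI allI)
  note even_series = iterated_flux_series[where p = "\<lambda>n. 2 * n + 1" and h = sin and m = m,
      OF _ sin_paired _ _ even_term_flux_form]
  note odd_series = iterated_flux_series[where p = "\<lambda>n. 2 * n" and h = cos and m = m,
      OF _ cos_paired _ _ odd_term_flux_form]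
  have mono: "strict_mono (\<lambda>n::nat. 2 * n + 1)" "strict_mono (\<lambda>n::nat. 2 * n)"
    by (auto simp: strict_mono_def)
  have trig: "continuous_on UNIV (sin :: real \<Rightarrow> real)" "continuous_on UNIV (cos :: real \<Rightarrow> real)"
    by (intro continuous_intros)+
  show "iter_summable (even_term c m r)" for r
    by (rule even_series(1)) (use mono trig in auto)
  show "iter_summable (odd_term c m r)" for r
    by (rule odd_series(1)) (use mono trig in auto)
  define A where "A = (\<lambda>r. real m * (t - sqrt (r\<^sup>2 + 1) / c))"
  have A: "A r = real m * t - real m * sqrt (r\<^sup>2 + 1) / c" for r
    by (simp add: A_def right_diff_distrib)
  show "(\<lambda>r. P_flux \<epsilon>0 \<mu>0 c m r t
         - beta_coeff \<mu>0 c r * gamma_coeff \<epsilon>0 c r * (real m)\<^sup>2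
           * (- (sin (real m * t))\<^sup>2 * (cos (real m * sqrt (r\<^sup>2 + 1) / c))\<^sup>2
              - (cos (real m * t))\<^sup>2 * (sin (real m * sqrt (r\<^sup>2 + 1) / c))\<^sup>2
              + 2 * sin (real m * t) * cos (real m * t)
                  * sin (real m * sqrt (r\<^sup>2 + 1) / c) * cos (real m * sqrt (r\<^sup>2 + 1) / c))
           * (\<Sum>w. \<Sum>w'. even_term c m r w w')) \<in> O[at_top](\<lambda>r. 1 / r)" if "even m"
  proof -
    \<comment> \<open>The bracket is minus the square of the subtraction formula for sin (m t - m R
      / c); the odd case uses the one for the cosine.\<close>
    have S: "- (sin (real m * t))\<^sup>2 * (cos (real m * sqrt (r\<^sup>2 + 1) / c))\<^sup>2
              - (cos (real m * t))\<^sup>2 * (sin (real m * sqrt (r\<^sup>2 + 1) / c))\<^sup>2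
              + 2 * sin (real m * t) * cos (real m * t)
                  * sin (real m * sqrt (r\<^sup>2 + 1) / c) * cos (real m * sqrt (r\<^sup>2 + 1) / c)
        = - (sin (A r))\<^sup>2" for r
      unfolding A sin_diff by (simp add: power2_eq_square algebra_simps)
    show ?thesis
      unfolding S
    proof (rule flux_asymptotics[OF assms(3,1,2), where h = sin and \<kappa> = "wave_number c m"])
      show "flux_form m (\<lambda>u. cos (far_phase c m r t u)) (\<lambda>u. cos (far_phase c m r t u)) \<phi> \<theta>
        = (sin (A r))\<^sup>2 * flux_form m (\<lambda>u. sin (wave_number c m r * u)) (\<lambda>u. sin (wave_number c m r * u)) \<phi> \<theta>"
        for r \<phi> \<theta>
        using that by (subst flux_form_phase[OF far_phase_wave_number]) (simp add: A_def)
      show "(\<Sum>w. \<Sum>w'. even_term c m r w w') = - (r ^ 3 *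
        iint (flux_form m (\<lambda>u. sin (wave_number c m r * u)) (\<lambda>u. sin (wave_number c m r * u))))" for r
        by (rule even_series(2)) (use mono trig in auto)
    qed (use trig in \<open>auto simp: abs_square_le_1\<close>)
  qed
  show "(\<lambda>r. P_flux \<epsilon>0 \<mu>0 c m r t
         - beta_coeff \<mu>0 c r * gamma_coeff \<epsilon>0 c r * (real m)\<^sup>2
           * (- (cos (real m * t))\<^sup>2 * (cos (real m * sqrt (r\<^sup>2 + 1) / c))\<^sup>2
              - (sin (real m * t))\<^sup>2 * (sin (real m * sqrt (r\<^sup>2 + 1) / c))\<^sup>2
              - 2 * sin (real m * t) * cos (real m * t)
                  * sin (real m * sqrt (r\<^sup>2 + 1) / c) * cos (real m * sqrt (r\<^sup>2 + 1) / c))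
           * (\<Sum>w. \<Sum>w'. odd_term c m r w w')) \<in> O[at_top](\<lambda>r. 1 / r)" if "odd m"
  proof -
    have S: "- (cos (real m * t))\<^sup>2 * (cos (real m * sqrt (r\<^sup>2 + 1) / c))\<^sup>2
              - (sin (real m * t))\<^sup>2 * (sin (real m * sqrt (r\<^sup>2 + 1) / c))\<^sup>2
              - 2 * sin (real m * t) * cos (real m * t)
                  * sin (real m * sqrt (r\<^sup>2 + 1) / c) * cos (real m * sqrt (r\<^sup>2 + 1) / c)
        = - (cos (A r))\<^sup>2" for r
      unfolding A cos_diff by (simp add: power2_eq_square algebra_simps)
    show ?thesis
      unfolding S
    proof (rule flux_asymptotics[OF assms(3,1,2), where h = cos and \<kappa> = "wave_number c m"])
      show "flux_form m (\<lambda>u. cos (far_phase c m r t u)) (\<lambda>u. cos (far_phase c m r t u)) \<phi> \<theta>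
        = (cos (A r))\<^sup>2 * flux_form m (\<lambda>u. cos (wave_number c m r * u)) (\<lambda>u. cos (wave_number c m r * u)) \<phi> \<theta>"
        for r \<phi> \<theta>
        using that by (subst flux_form_phase[OF far_phase_wave_number]) (simp add: A_def)
      show "(\<Sum>w. \<Sum>w'. odd_term c m r w w') = - (r ^ 3 *
        iint (flux_form m (\<lambda>u. cos (wave_number c m r * u)) (\<lambda>u. cos (wave_number c m r * u))))" for r
        by (rule odd_series(2)) (use mono trig in auto)
    qed (use trig in \<open>auto simp: abs_square_le_1\<close>)
  qed
qed

end
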